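(* Let $\xi\ge2$ be a countable ordinal, let $(X,\tau)$ be an uncountable Polish space and let $\zeta$ be a nonzero countable ordinal. Then there exist $f,g\in\mathfrak B_\xi(X,\tau)$ such that $\beta^*_\xi(f)\le\omega^\zeta$, $\beta^*_\xi(g)\le\omega^\zeta$ and $\beta^*_\xi(fg)>\omega^\zeta$. In particular $\beta^*_\xi$ is not essentially multiplicative.
   Context: Baire classes $\mathfrak B_\xi(X,\tau)$: $\mathfrak B_0$ = continuous real functions; $\mathfrak B_\xi$ = pointwise limits of sequences in $\bigcup_{\zeta<\xi}\mathfrak B_\zeta$. Borel classes: $\Sigma^0_1(\tau)=\tau$, $\Pi^0_\xi(\tau)=\{F:F^c\in\Sigma^0_\xi(\tau)\}$, $\Sigma^0_\xi(\tau)=\{\bigcup_nA_n:A_n\in\Pi^0_{\xi_n}(\tau),\xi_n<\xi\}$ for $\xi>1$. For a Polish topology $\tau'$ on $X$, $\beta_{\tau'}$ is the oscillation rank in $(X,\tau')$: for $f:X\to\mathbb R$, $\varepsilon>0$ and closed $F$, $D^0_{\tau'}(f,\varepsilon,F)=F$, $D^1_{\tau'}(f,\varepsilon,F)$ = set of $x\in F$ such that every $\tau'$-neighbourhood $U$ of $x$ contains $x_1,x_2\in F\cap U$ with $|f(x_1)-f(x_2)|\ge\varepsilon$, iterated transfinitely (intersections at limits); $\beta_{\tau'}(f,\varepsilon)$ = least $\alpha$ with $D^\alpha_{\tau'}(f,\varepsilon,X)=\emptyset$ ($\omega_1$ if none), $\beta_{\tau'}(f)=\sup_{\varepsilon>0}\beta_{\tau'}(f,\varepsilon)$.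 For $f\in\mathfrak B_\xi(X,\tau)$, $T_{f,\xi}$ is the (nonempty) set of Polish topologies $\tau'$ with $\tau\subseteq\tau'\subseteq\Sigma^0_\xi(\tau)$ and $f\in\mathfrak B_1(X,\tau')$, and $\beta^*_\xi(f)=\min_{\tau'\in T_{f,\xi}}\beta_{\tau'}(f)$. *)

theory Defs
  imports "HOL-Analysis.Analysis"
begin

text \<open>A (countable) ordinal is represented by a well-order relation r (in the sense of
  Main's Well_order, i.e. reflexive on its field); the ordinal is the order type of r.
  An element a of Field r stands for the ordinal given by the order type of the strict
  initial segment below a, so the elements of Field r are exactly the ordinals smaller
  than the order type of r.\<close>

definition wo_below :: "'o rel \<Rightarrow> 'o \<Rightarrow> 'o set" where
  "wo_below r a = {b. (b, a) \<in> r \<and> b \<noteq> a}"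

definition wo_rec :: "'o rel \<Rightarrow> ('o set \<Rightarrow> ('o \<Rightarrow> 'b) \<Rightarrow> 'b) \<Rightarrow> 'o \<Rightarrow> 'b" where
  "wo_rec r H = wfrec (r - Id) (\<lambda>F a. H (wo_below r a) F)"

text \<open>Value at the ordinal equal to the order type of r itself.\<close>
definition wo_top :: "'o rel \<Rightarrow> ('o set \<Rightarrow> ('o \<Rightarrow> 'b) \<Rightarrow> 'b) \<Rightarrow> 'b" where
  "wo_top r H = H (Field r) (wo_rec r H)"

text \<open>Ordinal exponentiation omega^zeta (zeta = order type of s): finitely supported
  functions from Field s to nat, compared at the s-largest point where they differ.\<close>
definition fin_supp :: "'z rel \<Rightarrow> ('z \<Rightarrow> nat) set" where
  "fin_supp s = {h. finite {z. h z \<noteq> 0} \<and> {z. h z \<noteq> 0} \<subseteq> Field s}"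

definition omega_exp :: "'z rel \<Rightarrow> ('z \<Rightarrow> nat) rel" where
  "omega_exp s = {(h, k). h \<in> fin_supp s \<and> k \<in> fin_supp s \<and>
     (h = k \<or> (\<exists>z\<in>Field s. h z < k z \<and>
        (\<forall>w\<in>Field s. (z, w) \<in> s \<and> w \<noteq> z \<longrightarrow> h w = k w)))}"

definition Polish_top :: "'a topology \<Rightarrow> bool" where
  "Polish_top T \<longleftrightarrow> completely_metrizable_space T \<and> separable_space T"

definition pw_limit :: "(nat \<Rightarrow> 'a \<Rightarrow> real) \<Rightarrow> ('a \<Rightarrow> real) \<Rightarrow> bool" where
  "pw_limit fs f \<longleftrightarrow> (\<forall>x. (\<lambda>n. fs n x) \<longlonglongrightarrow> f x)"

definition baire_step :: "'a topology \<Rightarrow> 'o set \<Rightarrow> ('o \<Rightarrow> ('a \<Rightarrow> real) set) \<Rightarrow> ('a \<Rightarrow> real) set" where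
  "baire_step T I F =
     (if I = {} then {f. continuous_map T euclideanreal f}
      else {f. \<exists>fs. (\<forall>n. \<exists>b\<in>I. fs n \<in> F b) \<and> pw_limit fs f})"

text \<open>Baire class B_xi(X,T), xi = order type of r (X is the whole type).\<close>
definition baire_class :: "'a topology \<Rightarrow> 'o rel \<Rightarrow> ('a \<Rightarrow> real) set" where
  "baire_class T r = wo_top r (baire_step T)"

definition baire_one :: "'a topology \<Rightarrow> ('a \<Rightarrow> real) set" where
  "baire_one T = {f. \<exists>fs. (\<forall>n. continuous_map T euclideanreal (fs n)) \<and> pw_limit fs f}"

text \<open>Sigma^0_eta: for eta \<le> 1 the open sets (only eta = 1 is ever used as a Sigma class;
  eta = 0 is excluded below), otherwise countable unions of complements of
  Sigma^0_{eta_n} sets with 1 \<le> eta_n < eta.\<close>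
definition sigma_step :: "'a topology \<Rightarrow> 'o rel \<Rightarrow> 'o set \<Rightarrow> ('o \<Rightarrow> 'a set set) \<Rightarrow> 'a set set" where
  "sigma_step T r I F =
     (if (\<exists>b. I \<subseteq> {b}) then {U. openin T U}
      else {U. \<exists>S :: nat \<Rightarrow> 'a set.
              (\<forall>n. \<exists>b\<in>I. wo_below r b \<noteq> {} \<and> S n \<in> F b) \<and>
              U = (\<Union>n. topspace T - S n)})"

definition sigma_class :: "'a topology \<Rightarrow> 'o rel \<Rightarrow> 'a set set" where
  "sigma_class T r = wo_top r (sigma_step T r)"

definition osc_step :: "'a topology \<Rightarrow> ('a \<Rightarrow> real) \<Rightarrow> real \<Rightarrow> 'a set \<Rightarrow> 'a set" where
  "osc_step T f \<epsilon> F = {x \<in> F. \<forall>U. openin T U \<and> x \<in> U \<longrightarrow>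
       (\<exists>x1\<in>F \<inter> U. \<exists>x2\<in>F \<inter> U. \<epsilon> \<le> \<bar>f x1 - f x2\<bar>)}"

text \<open>D^alpha = X \<inter> \<Inter>_{beta<alpha} D^1(D^beta) (D^0 = X); this is the usual iteration
  (successor: derivative, limit: intersection) since the sequence is decreasing.\<close>
definition osc_deriv_step :: "'a topology \<Rightarrow> ('a \<Rightarrow> real) \<Rightarrow> real \<Rightarrow> 'o set \<Rightarrow> ('o \<Rightarrow> 'a set) \<Rightarrow> 'a set" where
  "osc_deriv_step T f \<epsilon> I F = topspace T \<inter> (\<Inter>b\<in>I. osc_step T f \<epsilon> (F b))"

definition osc_deriv :: "'a topology \<Rightarrow> ('a \<Rightarrow> real) \<Rightarrow> real \<Rightarrow> 'o rel \<Rightarrow> 'a set" where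
  "osc_deriv T f \<epsilon> W = wo_top W (osc_deriv_step T f \<epsilon>)"

text \<open>beta_T(f) \<le> alpha (alpha = order type of W): for every eps > 0, beta_T(f,eps) \<le> alpha,
  i.e. (the derivatives being decreasing) D^alpha_T(f,eps,X) = {}.\<close>
definition beta_le :: "'a topology \<Rightarrow> ('a \<Rightarrow> real) \<Rightarrow> 'o rel \<Rightarrow> bool" where
  "beta_le T f W \<longleftrightarrow> (\<forall>\<epsilon>>0. osc_deriv T f \<epsilon> W = {})"

definition T_set :: "'a topology \<Rightarrow> 'o rel \<Rightarrow> ('a \<Rightarrow> real) \<Rightarrow> 'a topology set" where
  "T_set T r f = {T'. Polish_top T' \<and>
      (\<forall>U. openin T U \<longrightarrow> openin T' U) \<and>
      (\<forall>U. openin T' U \<longrightarrow> U \<in> sigma_class T r) \<and>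
      f \<in> baire_one T'}"

text \<open>beta*_xi(f) \<le> alpha: since beta*_xi(f) is the minimum of beta_T'(f) over T_{f,xi},
  this holds iff some T' in T_{f,xi} has beta_T'(f) \<le> alpha.\<close>
definition beta_star_le :: "'a topology \<Rightarrow> 'o rel \<Rightarrow> ('a \<Rightarrow> real) \<Rightarrow> 'w rel \<Rightarrow> bool" where
  "beta_star_le T r f W \<longleftrightarrow> (\<exists>T'\<in>T_set T r f. beta_le T' f W)"

end

theory Submission
  imports Defs "HOL-Library.Multiset"
begin

text \<open>Let \<open>\<lambda> = \<omega>\<^sup>\<zeta>\<close>. A set \<open>A\<close> whose indicator function has rank at most \<open>\<lambda>\<close> for some
  admissible topology is decided in \<open>\<lambda>\<close> stages: there are pairs of \<open>\<Sigma>\<^sub>\<xi>\<close> sets, indexed by the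
  ordinals below \<open>\<lambda>\<close>, such that \<open>x \<in> A\<close> depends only on which member of the first pair met by \<open>x\<close>
  contains it. Diagonalising against universal \<open>\<Sigma>\<^sub>\<xi>\<close> sets produces an \<open>A\<close>, empty outside the union
  of its own stages, that is not decided in this way, so its indicator function has rank
  greater than \<open>\<lambda>\<close> for every admissible topology. By the reduction property the union of the
  stages splits into disjoint \<open>\<Sigma>\<^sub>\<xi>\<close> sets \<open>U\<^sub>n\<close>, on each of which fewer than \<open>\<lambda>\<close> stages occur.
  With \<open>f = 1/(n+1)\<close> on \<open>A \<inter> U\<^sub>n\<close> and \<open>g = n+1\<close> on \<open>U\<^sub>n\<close> (both zero elsewhere), \<open>fg\<close> is the
  indicator function of \<open>A\<close>. In a Polish refinement making all these sets open, only
  finitely many \<open>U\<^sub>n\<close> contribute to the derivatives of \<open>f\<close> for a given \<open>\<epsilon>\<close>, and \<open>g\<close> is locally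
  constant on the union of the \<open>U\<^sub>n\<close>, so both have rank at most \<open>\<lambda>\<close>.\<close>

section \<open>Polish topologies\<close>

text \<open>The balls of radius 1/(n+1) about the points of a countable dense set form a countable
  base.\<close>

lemma separable_metrizable_imp_second_countable:
  assumes "metrizable_space X" "separable_space X"
  shows "second_countable X"
proof -
  obtain M d where "Metric_space M d" and X: "X = Metric_space.mtopology M d"
    using assms(1) metrizable_space_def by blast
  then interpret Metric_space M d by blast
  obtain C where C: "countable C" "C \<subseteq> M" "X closure_of C = M"
    using assms(2) unfolding separable_space_def X by auto
  define \<B> where "\<B> = (\<lambda>(c, n::nat). mball c (1 / real (Suc n))) ` (C \<times> UNIV)"
  show ?thesis
    unfolding second_countable_def
  proof (intro exI[of _ \<B>] conjI ballI allI impI)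
    show "countable \<B>"
      unfolding \<B>_def using C(1) by auto
    show "openin X V" if "V \<in> \<B>" for V
      using that unfolding \<B>_def X by auto
    fix U x
    assume "openin X U \<and> x \<in> U"
    then obtain e where e: "e > 0" "mball x e \<subseteq> U" and x: "x \<in> M"
      unfolding X openin_mtopology by blast
    obtain n where n: "1 / real (Suc n) < e / 2"
      using e(1) by (metis half_gt_zero nat_approx_posE)
    have "x \<in> X closure_of C" "openin X (mball x (1 / real (Suc n)))" "x \<in> mball x (1 / real (Suc n))"
      using x C(3) by (auto simp: X)
    then obtain c where c: "c \<in> C" "c \<in> mball x (1 / real (Suc n))"
      unfolding in_closure_of by blast
    have "mball c (1 / real (Suc n)) \<subseteq> mball x e"
    proof
      fix z assume z: "z \<in> mball c (1 / real (Suc n))"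
      have "d x z \<le> d x c + d c z"
        using triangle c z x by auto
      then show "z \<in> mball x e"
        using c z n x by auto
    qed
    moreover have "x \<in> mball c (1 / real (Suc n))"
      using c x by (simp add: commute)
    ultimately show "\<exists>V\<in>\<B>. x \<in> V \<and> V \<subseteq> U"
      using c(1) e(2) unfolding \<B>_def by blast
  qed
qed

lemma Polish_top_imp_metrizable: "Polish_top T \<Longrightarrow> metrizable_space T"
  unfolding Polish_top_def by (simp add: completely_metrizable_imp_metrizable_space)

lemma Polish_top_imp_second_countable: "Polish_top T \<Longrightarrow> second_countable T"
  using Polish_top_imp_metrizable separable_metrizable_imp_second_countable
  unfolding Polish_top_def by blast

text \<open>An injective \<open>h\<close> is a homeomorphism from the pullback topology onto its
  range, and a G-delta subspace of a completely metrizable space is completely metrizable. Both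
  refinement constructions below realise the finer topology as such a pullback.\<close>

lemma Polish_top_pullback:
  assumes Y: "completely_metrizable_space Y" "gdelta_in Y (range h)"
    and h: "inj h"
    and sc: "second_countable (pullback_topology UNIV h Y)"
  shows "Polish_top (pullback_topology UNIV h Y)"
proof -
  let ?P = "pullback_topology UNIV h Y"
  have sub: "range h \<subseteq> topspace Y"
    using Y(2) gdelta_in_subset by blast
  have top: "topspace ?P = UNIV"
    using sub by (auto simp: topspace_pullback_topology)
  have "homeomorphic_map ?P (subtopology Y (range h)) h"
  proof (rule bijective_open_imp_homeomorphic_map)
    have "continuous_map ?P Y (id \<circ> h)"
      by (intro continuous_map_pullback) simp
    then show "continuous_map ?P (subtopology Y (range h)) h"
      by (simp add: continuous_map_in_subtopology)
    show "open_map ?P (subtopology Y (range h)) h"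
      unfolding open_map_def openin_pullback_topology openin_subtopology by blast
    show "h ` topspace ?P = topspace (subtopology Y (range h))"
      using top sub by auto
    show "inj_on h (topspace ?P)"
      using h by (simp add: inj_on_def)
  qed
  then have "?P homeomorphic_space subtopology Y (range h)"
    by (rule homeomorphic_map_imp_homeomorphic_space)
  then have "completely_metrizable_space ?P"
    using completely_metrizable_space_gdelta_in[OF Y] homeomorphic_completely_metrizable_space by blast
  then show ?thesis
    using second_countable_imp_separable_space[OF sc] by (simp add: Polish_top_def)
qed

text \<open>The map x to (x, x \<in> S) embeds the refined space in the product of \<open>T\<close>
  with a two-point discrete space; its range is the union of an open and a closed set, hence a
  G-delta. The explicit form of the open sets is what later bounds their Borel class.\<close>

lemma Polish_top_add_closed:
  assumes T: "Polish_top T" "topspace T = UNIV" and S: "openin T S"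
  obtains T' where "Polish_top T'" "topspace T' = UNIV"
    "\<And>V. openin T' V \<longleftrightarrow> (\<exists>U W. openin T U \<and> openin T W \<and> V = (U \<inter> S) \<union> (W - S))"
proof
  let ?h = "\<lambda>x. (x, x \<in> S)"
  let ?Y = "prod_topology T (discrete_topology (UNIV :: bool set))"
  let ?P = "pullback_topology UNIV ?h ?Y"
  show op: "openin ?P V \<longleftrightarrow> (\<exists>U W. openin T U \<and> openin T W \<and> V = (U \<inter> S) \<union> (W - S))" for V
  proof
    assume "openin ?P V"
    then obtain Q where Q: "openin ?Y Q" "V = ?h -` Q"
      by (auto simp: openin_pullback_topology)
    have "continuous_map T ?Y (\<lambda>x. (x, b))" for b
      by (auto simp: continuous_map_pairwise o_def)
    then have "openin T {x \<in> topspace T. (x, b) \<in> Q}" for b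
      using Q(1) openin_continuous_map_preimage by fast
    then have "openin T {x. (x, True) \<in> Q}" "openin T {x. (x, False) \<in> Q}"
      using T(2) by (auto simp del: Collect_const)
    moreover have "V = ({x. (x, True) \<in> Q} \<inter> S) \<union> ({x. (x, False) \<in> Q} - S)"
    proof (rule set_eqI)
      show "x \<in> V \<longleftrightarrow> x \<in> ({x. (x, True) \<in> Q} \<inter> S) \<union> ({x. (x, False) \<in> Q} - S)" for x
        by (cases "x \<in> S") (auto simp: Q(2))
    qed
    ultimately show "\<exists>U W. openin T U \<and> openin T W \<and> V = (U \<inter> S) \<union> (W - S)"
      by blast
  next
    assume "\<exists>U W. openin T U \<and> openin T W \<and> V = (U \<inter> S) \<union> (W - S)"
    then obtain U W where UW: "openin T U" "openin T W" "V = (U \<inter> S) \<union> (W - S)"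
      by blast
    then have "openin ?Y (U \<times> {True} \<union> W \<times> {False})"
      by (intro openin_Un) (auto simp: openin_prod_Times_iff)
    moreover have "V = ?h -` (U \<times> {True} \<union> W \<times> {False})"
      using UW(3) by auto
    ultimately show "openin ?P V"
      unfolding openin_pullback_topology by blast
  qed
  show "topspace ?P = UNIV"
    using T(2) by (auto simp: topspace_pullback_topology)
  have cY: "completely_metrizable_space ?Y"
    using T(1) by (auto simp: Polish_top_def completely_metrizable_space_prod_topology
        completely_metrizable_space_discrete_topology)
  have "openin ?Y (S \<times> {True})"
    using S by (auto simp: openin_prod_Times_iff)
  moreover have "closedin ?Y ((- S) \<times> {False})"
    using S T(2) by (simp add: closedin_prod_Times_iff closedin_def[of T] Compl_eq_Diff_UNIV Diff_Diff_Int)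
  ultimately have "gdelta_in ?Y (S \<times> {True} \<union> (- S) \<times> {False})"
    using cY by (intro gdelta_in_Un open_imp_gdelta_in closed_imp_gdelta_in
        completely_metrizable_imp_metrizable_space)
  moreover have "range ?h = S \<times> {True} \<union> (- S) \<times> {False}"
    by auto
  ultimately have gd: "gdelta_in ?Y (range ?h)"
    by simp
  obtain \<B> where B: "countable \<B>" "\<And>V. V \<in> \<B> \<Longrightarrow> openin T V"
      "\<And>U x. openin T U \<Longrightarrow> x \<in> U \<Longrightarrow> \<exists>V\<in>\<B>. x \<in> V \<and> V \<subseteq> U"
    using Polish_top_imp_second_countable[OF T(1)] unfolding second_countable_def by metis
  have "second_countable ?P"
    unfolding second_countable_def
  proof (intro exI[of _ "(\<lambda>B. B \<inter> S) ` \<B> \<union> (\<lambda>B. B - S) ` \<B>"] conjI ballI allI impI)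
    show "countable ((\<lambda>B. B \<inter> S) ` \<B> \<union> (\<lambda>B. B - S) ` \<B>)"
      using B(1) by auto
    fix V assume "V \<in> (\<lambda>B. B \<inter> S) ` \<B> \<union> (\<lambda>B. B - S) ` \<B>"
    then obtain B where "B \<in> \<B>" "V = B \<inter> S \<union> ({} - S) \<or> V = {} \<inter> S \<union> (B - S)"
      by auto
    then show "openin ?P V"
      unfolding op using B(2) openin_empty by metis
  next
    fix V x assume V: "openin ?P V \<and> x \<in> V"
    then obtain U W where UW: "openin T U" "openin T W" "V = (U \<inter> S) \<union> (W - S)"
      unfolding op by blast
    show "\<exists>Va\<in>(\<lambda>B. B \<inter> S) ` \<B> \<union> (\<lambda>B. B - S) ` \<B>. x \<in> Va \<and> Va \<subseteq> V"
    proof (cases "x \<in> S")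
      case True
      then obtain B where "B \<in> \<B>" "x \<in> B" "B \<subseteq> U"
        using V UW B(3)[of U x] by auto
      then show ?thesis
        using True UW(3) by (intro bexI[of _ "B \<inter> S"]) auto
    next
      case False
      then obtain B where "B \<in> \<B>" "x \<in> B" "B \<subseteq> W"
        using V UW B(3)[of W x] by auto
      then show ?thesis
        using False UW(3) by (intro bexI[of _ "B - S"]) auto
    qed
  qed
  then show "Polish_top ?P"
    by (intro Polish_top_pullback cY gd) (auto simp: inj_on_def)
qed

text \<open>The common refinement is the diagonal of the product space, which is closed because
  all the topologies refine one Hausdorff topology.\<close>
lemma Polish_top_countable_join:
  fixes Ts :: "nat \<Rightarrow> 'a topology"
  assumes T: "Polish_top T" "topspace T = UNIV"
    and Ts: "\<And>n. Polish_top (Ts n)" "\<And>n. topspace (Ts n) = UNIV"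
    and finer: "\<And>n U. openin T U \<Longrightarrow> openin (Ts n) U"
  obtains T' \<B> where "Polish_top T'" "topspace T' = UNIV"
    "\<And>n U. openin (Ts n) U \<Longrightarrow> openin T' U"
    "countable \<B>" "\<And>V. openin T' V \<Longrightarrow> \<exists>\<U>\<subseteq>\<B>. V = \<Union>\<U>"
    "\<And>B. B \<in> \<B> \<Longrightarrow> \<exists>\<F>. finite \<F> \<and> B = \<Inter>\<F> \<and> (\<forall>F\<in>\<F>. \<exists>n. openin (Ts n) F)"
proof -
  let ?h = "\<lambda>(x::'a) (n::nat). x"
  let ?Y = "product_topology Ts UNIV"
  let ?P = "pullback_topology UNIV ?h ?Y"
  have topP: "topspace ?P = UNIV"
    using Ts(2) by (auto simp: topspace_pullback_topology)
  have fin: "openin ?P U" if "openin (Ts n) U" for n U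
  proof -
    have "openin ?Y {z \<in> topspace ?Y. z n \<in> U}"
      by (intro openin_continuous_map_preimage[of _ "Ts n"] continuous_map_product_projection that) simp
    moreover have "U = ?h -` {z \<in> topspace ?Y. z n \<in> U} \<inter> UNIV"
      using Ts(2) by auto
    ultimately show ?thesis
      unfolding openin_pullback_topology by blast
  qed
  have "\<exists>\<B>. countable \<B> \<and> (\<forall>V\<in>\<B>. openin (Ts n) V) \<and>
          (\<forall>U x. openin (Ts n) U \<and> x \<in> U \<longrightarrow> (\<exists>V\<in>\<B>. x \<in> V \<and> V \<subseteq> U))" for n
    using Polish_top_imp_second_countable[OF Ts(1)] unfolding second_countable_def .
  then obtain B where B: "\<And>n. countable (B n)" "\<And>n V. V \<in> B n \<Longrightarrow> openin (Ts n) V"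
      "\<And>n U x. openin (Ts n) U \<Longrightarrow> x \<in> U \<Longrightarrow> \<exists>V\<in>B n. x \<in> V \<and> V \<subseteq> U"
    by metis
  \<comment> \<open>Finite intersections of basic open sets of the factors form a base of the join.
    This form lets all its open sets be placed in a Borel class closed under finite intersections
    and countable unions.\<close>
  define \<B> where "\<B> = Inter ` {\<F>. finite \<F> \<and> \<F> \<subseteq> (\<Union>n. B n)}"
  have cB: "countable \<B>"
    unfolding \<B>_def by (intro countable_image countable_Collect_finite_subset countable_UN B(1)) simp
  have Bfin: "\<exists>\<F>. finite \<F> \<and> V = \<Inter>\<F> \<and> (\<forall>F\<in>\<F>. \<exists>n. openin (Ts n) F)" if V: "V \<in> \<B>" for V
  proof -
    obtain \<F> where F: "finite \<F>" "\<F> \<subseteq> (\<Union>n. B n)" "V = \<Inter>\<F>"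
      using V unfolding \<B>_def by blast
    have "\<forall>F\<in>\<F>. \<exists>n. openin (Ts n) F"
    proof
      fix F assume "F \<in> \<F>"
      then obtain n where "F \<in> B n"
        using F(2) by (meson UN_E subsetD)
      then show "\<exists>n. openin (Ts n) F"
        using B(2) by (intro exI)
    qed
    then show ?thesis
      using F(1,3) by (intro exI[of _ \<F>] conjI)
  qed
  have Bop: "openin ?P V" if V: "V \<in> \<B>" for V
  proof -
    obtain \<F> where F: "finite \<F>" "V = \<Inter>\<F>" "\<forall>F\<in>\<F>. \<exists>n. openin (Ts n) F"
      using Bfin[OF V] by blast
    show ?thesis
    proof (cases "\<F> = {}")
      case True
      then show ?thesis
        using F(2) topP openin_topspace[of ?P] by simp
    next
      case False
      show ?thesis
        unfolding F(2) by (rule openin_Inter[OF F(1) False]) (use F(3) fin in blast)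
    qed
  qed
  have base: "\<exists>V\<in>\<B>. x \<in> V \<and> V \<subseteq> U" if U: "openin ?P U" "x \<in> U" for U x
  proof -
    obtain Q where Q: "openin ?Y Q" "U = ?h -` Q"
      using U(1) by (auto simp: openin_pullback_topology)
    then obtain Z where Z: "finite {i. Z i \<noteq> UNIV}" "\<And>i. openin (Ts i) (Z i)"
        "?h x \<in> Pi\<^sub>E UNIV Z" "Pi\<^sub>E UNIV Z \<subseteq> Q"
      using U(2) unfolding openin_product_topology_alt Ts(2) by auto
    have "\<forall>i. \<exists>V\<in>B i. x \<in> V \<and> V \<subseteq> Z i"
      using B(3) Z(2,3) by (simp add: PiE_iff)
    then obtain V where V: "\<And>i. V i \<in> B i" "\<And>i. x \<in> V i" "\<And>i. V i \<subseteq> Z i"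
      by metis
    show ?thesis
    proof (intro bexI conjI)
      show "\<Inter> (V ` {i. Z i \<noteq> UNIV}) \<in> \<B>"
        unfolding \<B>_def using Z(1) V(1) by (intro imageI) auto
      show "x \<in> \<Inter> (V ` {i. Z i \<noteq> UNIV})"
        using V(2) by auto
      show "\<Inter> (V ` {i. Z i \<noteq> UNIV}) \<subseteq> U"
      proof
        fix y assume y: "y \<in> \<Inter> (V ` {i. Z i \<noteq> UNIV})"
        have "y \<in> Z i" for i
          using y V(3)[of i] by (cases "Z i = UNIV") auto
        then have "?h y \<in> Q"
          using Z(4) by (auto simp: PiE_iff)
        then show "y \<in> U"
          using Q(2) by simp
      qed
    qed
  qed
  have sc: "second_countable ?P"
    unfolding second_countable_def using cB Bop base by blast
  have "Hausdorff_space T"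
    using T(1) Polish_top_imp_metrizable metrizable_imp_Hausdorff_space by blast
  have "openin ?Y (topspace ?Y - range ?h)"
  proof (subst openin_subopen, intro ballI)
    fix z assume "z \<in> topspace ?Y - range ?h"
    then obtain m n where mn: "z m \<noteq> z n"
      by (metis DiffE ext rangeI)
    then obtain U V where UV: "openin T U" "openin T V" "z m \<in> U" "z n \<in> V" "disjnt U V"
      using \<open>Hausdorff_space T\<close> unfolding Hausdorff_space_def T(2) by (meson UNIV_I)
    let ?W = "{w \<in> topspace ?Y. w m \<in> U} \<inter> {w \<in> topspace ?Y. w n \<in> V}"
    have "openin ?Y ?W"
      by (intro openin_Int openin_continuous_map_preimage[of _ "Ts m"]
          openin_continuous_map_preimage[of _ "Ts n"] continuous_map_product_projection finer UV) auto
    moreover have "z \<in> ?W"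
      using UV Ts(2) by auto
    moreover have "?W \<subseteq> topspace ?Y - range ?h"
      using UV(5) by (auto simp: disjnt_iff)
    ultimately show "\<exists>W. openin ?Y W \<and> z \<in> W \<and> W \<subseteq> topspace ?Y - range ?h"
      by blast
  qed
  then have cl: "closedin ?Y (range ?h)"
    using Ts(2) by (auto simp: closedin_def)
  have cY: "completely_metrizable_space ?Y"
    using Ts(1) unfolding completely_metrizable_space_product_topology Polish_top_def by auto
  have "Polish_top ?P"
    using cY cl by (intro Polish_top_pullback sc closed_imp_gdelta_in
        completely_metrizable_imp_metrizable_space) (auto simp: inj_on_def fun_eq_iff)
  moreover have "\<exists>\<U>\<subseteq>\<B>. V = \<Union>\<U>" if "openin ?P V" for V
  proof (intro exI[of _ "{W \<in> \<B>. W \<subseteq> V}"] conjI)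
    show "V = \<Union> {W \<in> \<B>. W \<subseteq> V}"
      using base[OF that] by blast
  qed blast
  ultimately show thesis
    using that[of ?P \<B>] topP fin cB Bfin by blast
qed

section \<open>The Borel classes\<close>

text \<open>Initial segments stand for ordinals: \<open>Field r\<close> for the ordinal of
  \<open>r\<close> itself and \<open>wo_below r b\<close> for those below it. Indexing classes by
  segments treats the top value and the values of the recursion alike.\<close>

definition is_seg :: "'o rel \<Rightarrow> 'o set \<Rightarrow> bool" where
  "is_seg r I \<longleftrightarrow> I \<subseteq> Field r \<and> (\<forall>b\<in>I. wo_below r b \<subseteq> I)"

text \<open>Since \<open>H I F\<close> depends only on the values of \<open>F\<close> on
  \<open>I\<close>, the cut that \<open>wfrec\<close> makes outside the predecessors does not change
  the value.\<close>

lemma wo_rec_eq: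
  assumes "Well_order r"
    and cong: "\<And>I F G. (\<And>b. b \<in> I \<Longrightarrow> F b = G b) \<Longrightarrow> H I F = H I G"
  shows "wo_rec r H a = H (wo_below r a) (wo_rec r H)"
proof -
  have wf: "wf (r - Id)"
    using assms(1) by (simp add: well_order_on_def)
  show ?thesis
    unfolding wo_rec_def
    by (subst wfrec[OF wf], rule cong) (simp add: cut_apply wo_below_def)
qed

lemma wo_below_notin_iff:
  assumes "Well_order r" "a \<in> Field r" "b \<in> Field r"
  shows "a \<notin> wo_below r b \<longleftrightarrow> a = b \<or> b \<in> wo_below r a"
proof -
  have "total_on (Field r) r" "antisym r"
    using assms(1) by (auto simp: well_order_on_def linear_order_on_def partial_order_on_def)
  then show ?thesis
    using assms(2,3) unfolding wo_below_def total_on_def antisym_def by blast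
qed

lemma wo_below_trans:
  assumes "Well_order r" "a \<in> wo_below r b" "b \<in> wo_below r c"
  shows "a \<in> wo_below r c"
proof -
  have "trans r" "antisym r"
    using assms(1)
    by (auto simp: well_order_on_def linear_order_on_def partial_order_on_def preorder_on_def)
  then show ?thesis
    using assms(2,3) unfolding wo_below_def by (auto dest: transD antisymD)
qed

lemma wo_below_subset_Field: "wo_below r b \<subseteq> Field r"
  unfolding wo_below_def by (auto simp: Field_def)

lemma wo_below_FieldD: "d \<in> wo_below r c \<Longrightarrow> d \<in> Field r"
  using wo_below_subset_Field by fast

lemma is_seg_Field: "is_seg r (Field r)"
  unfolding is_seg_def using wo_below_subset_Field by fast

lemma is_seg_wo_below: "Well_order r \<Longrightarrow> is_seg r (wo_below r b)"
  unfolding is_seg_def using wo_below_subset_Field wo_below_trans by fast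

text \<open>A point of \<open>I\<close> outside \<open>J\<close> and a point of \<open>J\<close>
  outside \<open>I\<close> would be distinct and incomparable.\<close>

lemma is_seg_linear:
  assumes "Well_order r" "is_seg r I" "is_seg r J"
  shows "I \<subseteq> J \<or> J \<subseteq> I"
proof (rule ccontr)
  assume "\<not> (I \<subseteq> J \<or> J \<subseteq> I)"
  then obtain a b where "a \<in> I" "a \<notin> J" "b \<in> J" "b \<notin> I"
    by blast
  moreover from this have "a \<notin> wo_below r b" "b \<notin> wo_below r a"
    using assms(2,3) unfolding is_seg_def by blast+
  ultimately show False
    using wo_below_notin_iff[OF assms(1)] assms(2,3) unfolding is_seg_def by (metis subsetD)
qed

lemma wo_less_induct [consumes 1, case_names less]:
  assumes "Well_order r"
    and "\<And>a. (\<And>b. b \<in> wo_below r a \<Longrightarrow> P b) \<Longrightarrow> P a"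
  shows "P a"
proof -
  have "wf (r - Id)"
    using assms(1) by (simp add: well_order_on_def)
  then show ?thesis
    by (induction a rule: wf_induct_rule) (use assms(2) in \<open>auto simp: wo_below_def\<close>)
qed

text \<open>The step is required for arbitrary segments, not for points, so that the conclusion also
  covers the whole field, which no element of the order represents.\<close>

lemma seg_induct [consumes 2, case_names seg]:
  assumes "Well_order r" "is_seg r I"
    and step: "\<And>I. is_seg r I \<Longrightarrow> (\<And>b. b \<in> I \<Longrightarrow> P (wo_below r b)) \<Longrightarrow> P I"
  shows "P I"
proof -
  have "P (wo_below r b)" for b
    using assms(1)
  proof (induction b rule: wo_less_induct)
    case (less a)
    then show ?case
      using step is_seg_wo_below[OF assms(1)] by blast
  qed
  then show ?thesis
    using step assms(2) by blast
qed

section \<open>The additive Borel classes, their closure properties and the reduction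
  property\<close>

locale Polish_ordinal =
  fixes T :: "'a topology" and r :: "'o rel"
  assumes polish: "Polish_top T" and top: "topspace T = UNIV" and wo: "Well_order r"
begin

lemmas seg_below = is_seg_wo_below[OF wo]

text \<open>Order type at least 2, the case in which \<open>sigma_step\<close> takes unions of
  complements; below that it returns the open sets.\<close>

definition big :: "'o set \<Rightarrow> bool" where
  "big I \<longleftrightarrow> \<not> (\<exists>b. I \<subseteq> {b})"

definition Sig :: "'o set \<Rightarrow> 'a set set" where
  "Sig I = sigma_step T r I (wo_rec r (sigma_step T r))"

lemma sigma_class_eq: "sigma_class T r = Sig (Field r)"
  unfolding sigma_class_def Sig_def wo_top_def ..

lemma wo_rec_sigma: "wo_rec r (sigma_step T r) b = Sig (wo_below r b)"
  unfolding Sig_def by (rule wo_rec_eq[OF wo]) (auto simp: sigma_step_def)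

lemma Sig_small: "\<not> big I \<Longrightarrow> Sig I = {U. openin T U}"
  unfolding Sig_def big_def by (simp add: sigma_step_def)

lemma Sig_bigE:
  assumes "big I" "U \<in> Sig I"
  obtains S b where "\<And>n::nat. b n \<in> I" "\<And>n. wo_below r (b n) \<noteq> {}"
    "\<And>n. S n \<in> Sig (wo_below r (b n))" "U = (\<Union>n. - S n)"
proof -
  obtain S :: "nat \<Rightarrow> 'a set" where S: "\<forall>n. \<exists>b\<in>I. wo_below r b \<noteq> {} \<and> S n \<in> Sig (wo_below r b)"
      "U = (\<Union>n. - S n)"
    using assms unfolding Sig_def[of I] sigma_step_def big_def wo_rec_sigma top
    by (auto simp: Compl_eq_Diff_UNIV)
  then show thesis
    using that by metis
qed

lemma Sig_bigI:
  assumes "big I" "\<And>n::nat. b n \<in> I" "\<And>n. wo_below r (b n) \<noteq> {}"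
    "\<And>n. S n \<in> Sig (wo_below r (b n))"
  shows "(\<Union>n. - S n) \<in> Sig I"
proof -
  have "\<exists>S'::nat \<Rightarrow> 'a set. (\<forall>n. \<exists>b\<in>I. wo_below r b \<noteq> {} \<and> S' n \<in> Sig (wo_below r b)) \<and>
      (\<Union>n. - S n) = (\<Union>n. UNIV - S' n)"
    by (rule exI[of _ S]) (use assms(2-4) in \<open>fastforce simp: Compl_eq_Diff_UNIV\<close>)
  then show ?thesis
    using assms(1) unfolding Sig_def[of I] sigma_step_def big_def wo_rec_sigma top by simp
qed

lemma Sig_Compl:
  assumes "big I" "b \<in> I" "wo_below r b \<noteq> {}" "S \<in> Sig (wo_below r b)"
  shows "- S \<in> Sig I"
  using Sig_bigI[of I "\<lambda>_. b" "\<lambda>_. S"] assms by simp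

text \<open>The larger of two elements has a predecessor, so it stands for a nonzero ordinal; these
  are the only indices from which the recursion for \<open>Sig\<close> takes complements.\<close>

lemma big_nonzero:
  assumes "is_seg r I" "big I"
  obtains b where "b \<in> I" "wo_below r b \<noteq> {}"
proof -
  obtain a where a: "a \<in> I"
    using assms(2) unfolding big_def by blast
  obtain b where b: "b \<in> I" "b \<noteq> a"
    using assms(2) a unfolding big_def by blast
  have "a \<in> wo_below r b \<or> b \<in> wo_below r a"
    using wo_below_notin_iff[OF wo, of a b] a b assms(1) unfolding is_seg_def by blast
  then show thesis
    using that a b by blast
qed

text \<open>An open set in a metrizable space is a countable union of closed sets, and by induction
  their open complements lie in every lower class.\<close>

lemma openin_subset_Sig:
  assumes "is_seg r I"
  shows "{U. openin T U} \<subseteq> Sig I"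
  using wo assms
proof (induction I rule: seg_induct)
  case (seg I)
  show ?case
  proof (cases "big I")
    case True
    show ?thesis
    proof safe
      fix U assume U: "openin T U"
      obtain b where b: "b \<in> I" "wo_below r b \<noteq> {}"
        using big_nonzero seg.hyps True by blast
      have "fsigma_in T U"
        using open_imp_fsigma_in[OF Polish_top_imp_metrizable[OF polish] U] .
      then obtain C :: "nat \<Rightarrow> 'a set" where C: "\<And>n. closedin T (C n)" "(\<Union>n. C n) = U"
        unfolding fsigma_in_ascending by blast
      have "- C n \<in> Sig (wo_below r b)" for n
        using seg.IH[OF b(1)] C(1)[of n] top by (auto simp: closedin_def Compl_eq_Diff_UNIV)
      then have "(\<Union>n. - (- C n)) \<in> Sig I"
        by (rule Sig_bigI[OF True b])
      then show "U \<in> Sig I"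
        using C(2) by simp
    qed
  next
    case False
    then show ?thesis
      by (simp add: Sig_small)
  qed
qed

lemma Sig_mono:
  assumes "is_seg r J" "I \<subseteq> J"
  shows "Sig I \<subseteq> Sig J"
proof (cases "big I")
  case True
  then have "big J"
    using assms(2) unfolding big_def by blast
  show ?thesis
  proof
    fix U assume "U \<in> Sig I"
    then obtain S b where "\<And>n::nat. b n \<in> I" "\<And>n. wo_below r (b n) \<noteq> {}"
        "\<And>n. S n \<in> Sig (wo_below r (b n))" and U: "U = (\<Union>n. - S n)"
      using Sig_bigE[OF True] by metis
    then show "U \<in> Sig J"
      unfolding U using assms(2) by (intro Sig_bigI[OF \<open>big J\<close>, of b]) auto
  qed
next
  case False
  then show ?thesis
    using openin_subset_Sig[OF assms(1)] by (simp add: Sig_small)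
qed

lemma Sig_below_subset: "is_seg r I \<Longrightarrow> b \<in> I \<Longrightarrow> Sig (wo_below r b) \<subseteq> Sig I"
  by (rule Sig_mono) (auto simp: is_seg_def)

lemma Sig_UN:
  assumes "\<And>n::nat. V n \<in> Sig I"
  shows "(\<Union>n. V n) \<in> Sig I"
proof (cases "big I")
  case True
  have "\<exists>S b. (\<forall>m::nat. b m \<in> I \<and> wo_below r (b m) \<noteq> {} \<and> S m \<in> Sig (wo_below r (b m)))
          \<and> V n = (\<Union>m. - S m)" for n
    using Sig_bigE[OF True assms[of n]] by metis
  then obtain S b where S: "\<And>n m::nat. b n m \<in> I \<and> wo_below r (b n m) \<noteq> {} \<and> S n m \<in> Sig (wo_below r (b n m))"
      and V: "\<And>n. V n = (\<Union>m. - S n m)"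
    by metis
  have "(\<Union>k. - case_prod S (prod_decode k)) \<in> Sig I"
    by (rule Sig_bigI[OF True, of "\<lambda>k. case_prod b (prod_decode k)"]) (auto simp: S split: prod.split)
  also have "(\<Union>k. - case_prod S (prod_decode k)) = (\<Union>n. V n)"
  proof -
    have "(\<Union>k. - case_prod S (prod_decode k)) = (\<Union>p\<in>range prod_decode. - case_prod S p)"
      by auto
    also have "\<dots> = (\<Union>n. V n)"
      unfolding surj_prod_decode V by auto
    finally show ?thesis .
  qed
  finally show ?thesis .
next
  case False
  then show ?thesis
    using assms by (auto simp: Sig_small)
qed

lemma Sig_Un:
  assumes "U \<in> Sig I" "V \<in> Sig I"
  shows "U \<union> V \<in> Sig I"
proof -
  have "(\<Union>n::nat. if n = 0 then U else V) \<in> Sig I"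
    using assms by (intro Sig_UN) auto
  also have "(\<Union>n::nat. if n = 0 then U else V) = U \<union> V"
    by (auto split: if_splits)
  finally show ?thesis .
qed

text \<open>Distributing the unions leaves complements of \<open>S n \<union> S' m\<close>; since
  segments are comparable, both sets lie in the larger of the two lower classes.\<close>

lemma Sig_Int:
  assumes "is_seg r I" "U \<in> Sig I" "V \<in> Sig I"
  shows "U \<inter> V \<in> Sig I"
proof (cases "big I")
  case True
  obtain S b where S: "\<And>n::nat. b n \<in> I" "\<And>n. wo_below r (b n) \<noteq> {}"
        "\<And>n. S n \<in> Sig (wo_below r (b n))" and U: "U = (\<Union>n. - S n)"
    using Sig_bigE[OF True assms(2)] by metis
  obtain S' b' where S': "\<And>n::nat. b' n \<in> I" "\<And>n. wo_below r (b' n) \<noteq> {}"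
        "\<And>n. S' n \<in> Sig (wo_below r (b' n))" and V: "V = (\<Union>n. - S' n)"
    using Sig_bigE[OF True assms(3)] by metis
  have "- S n \<inter> - S' m \<in> Sig I" for n m
  proof -
    have "\<exists>c\<in>I. wo_below r c \<noteq> {} \<and> S n \<in> Sig (wo_below r c) \<and> S' m \<in> Sig (wo_below r c)"
      using is_seg_linear[OF wo seg_below seg_below, of "b n" "b' m"]
    proof
      assume "wo_below r (b n) \<subseteq> wo_below r (b' m)"
      then show ?thesis
        using S S' Sig_mono[OF seg_below] by blast
    next
      assume "wo_below r (b' m) \<subseteq> wo_below r (b n)"
      then show ?thesis
        using S S' Sig_mono[OF seg_below] by blast
    qed
    then obtain c where "c \<in> I" "wo_below r c \<noteq> {}" "S n \<union> S' m \<in> Sig (wo_below r c)"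
      using Sig_Un by blast
    then show ?thesis
      using Sig_Compl[OF True] by force
  qed
  then have "(\<Union>n m. - S n \<inter> - S' m) \<in> Sig I"
    by (intro Sig_UN)
  also have "(\<Union>n m. - S n \<inter> - S' m) = U \<inter> V"
    unfolding U V by blast
  finally show ?thesis .
next
  case False
  then show ?thesis
    using assms by (auto simp: Sig_small)
qed

lemma UNIV_Sig: "is_seg r I \<Longrightarrow> UNIV \<in> Sig I"
  using openin_subset_Sig openin_topspace[of T] top by auto

lemma empty_Sig: "is_seg r I \<Longrightarrow> {} \<in> Sig I"
  using openin_subset_Sig openin_empty by blast

lemma Sig_Inter_finite:
  assumes "finite \<F>" "is_seg r I" "\<F> \<subseteq> Sig I"
  shows "\<Inter>\<F> \<in> Sig I"
  using assms by (induction \<F> rule: finite_induct) (auto simp: UNIV_Sig Sig_Int)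

lemma Sig_Union_countable:
  assumes "countable \<U>" "is_seg r I" "\<U> \<subseteq> Sig I"
  shows "\<Union>\<U> \<in> Sig I"
proof (cases "\<U> = {}")
  case False
  then have "(\<Union>n. from_nat_into \<U> n) \<in> Sig I"
    using assms(3) from_nat_into[OF False] by (intro Sig_UN) (rule subsetD)
  then show ?thesis
    using assms(1) False by (metis range_from_nat_into)
qed (simp add: empty_Sig assms(2))

text \<open>Each \<open>V n\<close> is a countable union of sets that lie in the class together with
  their complements. All these sets are put in one sequence \<open>B\<close>, made disjoint by
  removing earlier members, and each remainder is returned to the \<open>V n\<close> it came
  from.\<close>

lemma Sig_reduction:
  assumes I: "is_seg r I" "big I" and V: "\<And>n::nat. V n \<in> Sig I"
  obtains U where "\<And>n::nat. U n \<in> Sig I" "\<And>n. U n \<subseteq> V n" "(\<Union>n. U n) = (\<Union>n. V n)"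
    "\<And>m n. m \<noteq> n \<Longrightarrow> U m \<inter> U n = {}"
proof -
  have "\<exists>A. (\<forall>m::nat. A m \<in> Sig I \<and> - A m \<in> Sig I) \<and> V n = (\<Union>m. A m)" for n
  proof -
    obtain S b where "\<And>m::nat. b m \<in> I" "\<And>m. wo_below r (b m) \<noteq> {}"
        "\<And>m. S m \<in> Sig (wo_below r (b m))" "V n = (\<Union>m. - S m)"
      using Sig_bigE[OF I(2) V[of n]] by metis
    moreover from this have "- S m \<in> Sig I \<and> S m \<in> Sig I" for m
      using Sig_Compl[OF I(2)] Sig_below_subset[OF I(1)] by blast
    ultimately show ?thesis
      by (intro exI[of _ "\<lambda>m. - S m"]) simp
  qed
  then obtain A where A: "\<And>n m::nat. A n m \<in> Sig I" "\<And>n m. - A n m \<in> Sig I"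
      and VA: "\<And>n. V n = (\<Union>m. A n m)"
    by metis
  define B where "B i = case_prod A (prod_decode i)" for i
  define E where "E i = B i \<inter> \<Inter> ((\<lambda>j. - B j) ` {..<i})" for i
  have E: "E i \<in> Sig I" for i
    unfolding E_def B_def using A
    by (intro Sig_Int Sig_Inter_finite I) (auto split: prod.split)
  have disj: "E i \<inter> E j = {}" if "i \<noteq> j" for i j
    using that unfolding E_def by (auto simp: neq_iff)
  define U where "U n = (\<Union>m. E (prod_encode (n, m)))" for n
  show thesis
  proof
    show "U n \<in> Sig I" for n
      unfolding U_def using E by (intro Sig_UN)
    show sub: "U n \<subseteq> V n" for n
      unfolding U_def VA E_def B_def by auto
    show "U m \<inter> U n = {}" if "m \<noteq> n" for m n
    proof -
      have "E (prod_encode (m, a)) \<inter> E (prod_encode (n, b)) = {}" for a b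
        using that by (intro disj) (simp add: prod_encode_eq)
      then show ?thesis
        unfolding U_def by blast
    qed
    show "(\<Union>n. U n) = (\<Union>n. V n)"
    proof (rule antisym)
      show "(\<Union>n. U n) \<subseteq> (\<Union>n. V n)"
        using sub by blast
      show "(\<Union>n. V n) \<subseteq> (\<Union>n. U n)"
      proof
        fix x assume "x \<in> (\<Union>n. V n)"
        then obtain n m where "x \<in> A n m"
          unfolding VA by blast
        then have "\<exists>i. x \<in> B i"
          unfolding B_def by (intro exI[of _ "prod_encode (n, m)"]) simp
        then obtain i where i: "x \<in> B i" "\<And>j. j < i \<Longrightarrow> x \<notin> B j"
          using exists_least_iff[of "\<lambda>i. x \<in> B i"] by blast
        then have "x \<in> E i"
          unfolding E_def by simp
        moreover obtain a c where "i = prod_encode (a, c)"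
          by (metis prod_decode_inverse surj_pair)
        ultimately show "x \<in> (\<Union>n. U n)"
          unfolding U_def by auto
      qed
    qed
  qed
qed

text \<open>For \<open>I = Field r\<close> these are the topologies of \<open>T_set\<close> without
  the condition on the function. Other segments are allowed so that refinements can be built by
  induction on the class.\<close>

definition refines :: "'o set \<Rightarrow> 'a topology \<Rightarrow> bool" where
  "refines I T' \<longleftrightarrow> Polish_top T' \<and> topspace T' = UNIV \<and> (\<forall>U. openin T U \<longrightarrow> openin T' U) \<and>
    {U. openin T' U} \<subseteq> Sig I"

text \<open>The join has a countable base of finite intersections of sets from \<open>Sig I\<close>,
  and \<open>Sig I\<close> is closed under finite intersections and countable unions.\<close>

lemma refines_join:
  assumes I: "is_seg r I" and ex: "\<And>n::nat. \<exists>T'. refines I T' \<and> openin T' (V n)"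
  shows "\<exists>T'. refines I T' \<and> (\<forall>n. openin T' (V n))"
proof -
  obtain Ts where Ts: "\<And>n. refines I (Ts n)" and V: "\<And>n. openin (Ts n) (V n)"
    using ex by metis
  have pre: "\<And>n. Polish_top (Ts n)" "\<And>n. topspace (Ts n) = UNIV"
      "\<And>n U. openin T U \<Longrightarrow> openin (Ts n) U" and sub: "\<And>n. {U. openin (Ts n) U} \<subseteq> Sig I"
    using Ts unfolding refines_def by auto
  obtain T' \<B> where T': "Polish_top T'" "topspace T' = UNIV"
      and fin: "\<And>n U. openin (Ts n) U \<Longrightarrow> openin T' U"
      and B: "countable \<B>" "\<And>V. openin T' V \<Longrightarrow> \<exists>\<U>\<subseteq>\<B>. V = \<Union>\<U>"
      "\<And>B. B \<in> \<B> \<Longrightarrow> \<exists>\<F>. finite \<F> \<and> B = \<Inter>\<F> \<and> (\<forall>F\<in>\<F>. \<exists>n. openin (Ts n) F)"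
    using Polish_top_countable_join[OF polish top, of Ts, OF pre] by metis
  have BS: "\<B> \<subseteq> Sig I"
  proof
    fix B assume "B \<in> \<B>"
    then obtain \<F> where F: "finite \<F>" "B = \<Inter>\<F>" "\<forall>F\<in>\<F>. \<exists>n. openin (Ts n) F"
      using B(3) by blast
    then have "\<F> \<subseteq> Sig I"
      using sub by blast
    then show "B \<in> Sig I"
      using Sig_Inter_finite[OF F(1) I] F(2) by simp
  qed
  have "U \<in> Sig I" if "openin T' U" for U
  proof -
    obtain \<U> where U: "\<U> \<subseteq> \<B>" "U = \<Union>\<U>"
      using B(2)[OF \<open>openin T' U\<close>] by blast
    show ?thesis
      unfolding U(2) using U(1) BS countable_subset[OF U(1) B(1)]
      by (intro Sig_Union_countable I) auto
  qed
  then have "refines I T'"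
    using T' fin Ts unfolding refines_def by blast
  then show ?thesis
    using fin V by blast
qed

text \<open>Kuratowski's refinement theorem: a set in \<open>\<Sigma>\<^sub>\<xi>\<close> is a countable union of sets closed in
  refinements of lower class, and a closed set can be made open without losing Polishness.\<close>
lemma Sig_refinement:
  assumes "is_seg r I" "V \<in> Sig I"
  shows "\<exists>T'. refines I T' \<and> openin T' V"
  using wo assms
proof (induction I arbitrary: V rule: seg_induct)
  case (seg I)
  show ?case
  proof (cases "big I")
    case False
    then show ?thesis
      using polish top seg.prems by (auto simp: Sig_small refines_def)
  next
    case True
    obtain S b where b: "\<And>n::nat. b n \<in> I" "\<And>n. wo_below r (b n) \<noteq> {}"
        and S: "\<And>n. S n \<in> Sig (wo_below r (b n))" "V = (\<Union>n. - S n)"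
      using Sig_bigE[OF True seg.prems] by metis
    have "\<exists>T'. refines I T' \<and> openin T' (- S n)" for n
    proof -
      obtain T1 where T1: "refines (wo_below r (b n)) T1" "openin T1 (S n)"
        using seg.IH[OF b(1) S(1)] by blast
      obtain T2 where T2: "Polish_top T2" "topspace T2 = UNIV"
          and op: "\<And>V. openin T2 V \<longleftrightarrow> (\<exists>U W. openin T1 U \<and> openin T1 W \<and> V = (U \<inter> S n) \<union> (W - S n))"
        using Polish_top_add_closed[OF _ _ T1(2)] T1(1) unfolding refines_def by metis
      have "openin T2 U" if "openin T U" for U
      proof -
        have "openin T1 U"
          using that T1(1) by (simp add: refines_def)
        then show ?thesis
          unfolding op by (intro exI[of _ U]) auto
      qed
      \<comment> \<open>Open sets of \<open>T2\<close> are built from \<open>T1\<close>-open sets,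
        \<open>S n\<close> and \<open>- S n\<close>. The first two kinds are of lower class, and
        \<open>- S n\<close> lies in \<open>Sig I\<close> because complements go up one
        class.\<close>
      moreover have "{U. openin T2 U} \<subseteq> Sig I"
      proof safe
        fix Q assume "openin T2 Q"
        then obtain U W where UW: "openin T1 U" "openin T1 W" "Q = (U \<inter> S n) \<union> (W - S n)"
          unfolding op by blast
        have "- S n \<in> Sig I"
          using Sig_Compl[OF True b S(1)] .
        moreover have "U \<in> Sig I" "W \<in> Sig I" "S n \<in> Sig I"
          using UW(1,2) T1 Sig_below_subset[OF seg.hyps b(1)] unfolding refines_def by blast+
        ultimately show "Q \<in> Sig I"
          unfolding UW(3) Diff_eq by (intro Sig_Un Sig_Int seg.hyps)
      qed
      moreover have "openin T2 (- S n)"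
        unfolding op using T1(1) openin_topspace[of T1] openin_empty[of T1]
        by (intro exI[of _ "{}"] exI[of _ UNIV]) (auto simp: refines_def)
      ultimately show ?thesis
        using T2 unfolding refines_def by blast
    qed
    then obtain T' where "refines I T'" "\<forall>n. openin T' (- S n)"
      using refines_join[OF seg.hyps, of "\<lambda>n. - S n"] by blast
    moreover from this have "openin T' V"
      unfolding S(2) by (intro openin_Union) auto
    ultimately show ?thesis by blast
  qed
qed

end

section \<open>Baire functions\<close>

definition fun_alg :: "('a \<Rightarrow> real) set \<Rightarrow> bool" where
  "fun_alg A \<longleftrightarrow> (\<forall>c. (\<lambda>x. c) \<in> A) \<and>
     (\<forall>f\<in>A. \<forall>g\<in>A. (\<lambda>x. f x + g x) \<in> A \<and> (\<lambda>x. f x * g x) \<in> A)"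

definition pw_limits :: "('a \<Rightarrow> real) set \<Rightarrow> ('a \<Rightarrow> real) set" where
  "pw_limits A = {f. \<exists>fs. (\<forall>n. fs n \<in> A) \<and> pw_limit fs f}"

text \<open>Here the approximants reach the limit exactly at each point. This stronger convergence
  lets later factors cancel infinitely many terms with unbounded coefficients in
  \<open>const_on_cover_pw_limits\<close>.\<close>

definition ev_limits :: "('a \<Rightarrow> real) set \<Rightarrow> ('a \<Rightarrow> real) set" where
  "ev_limits A = {f. \<exists>fs. (\<forall>n. fs n \<in> A) \<and> (\<forall>x. \<forall>\<^sub>F n in sequentially. fs n x = f x)}"

lemma ev_limits_subset: "ev_limits A \<subseteq> pw_limits A"
  unfolding ev_limits_def pw_limits_def pw_limit_def by (auto intro: tendsto_eventually)

lemma subset_pw_limits: "A \<subseteq> pw_limits A"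
proof
  fix f assume "f \<in> A"
  then show "f \<in> pw_limits A"
    unfolding pw_limits_def pw_limit_def by (auto intro!: exI[of _ "\<lambda>_. f"])
qed

lemma fun_algD:
  assumes "fun_alg A"
  shows "(\<lambda>x. c) \<in> A" "f \<in> A \<Longrightarrow> g \<in> A \<Longrightarrow> (\<lambda>x. f x + g x) \<in> A"
    "f \<in> A \<Longrightarrow> g \<in> A \<Longrightarrow> (\<lambda>x. f x * g x) \<in> A"
  using assms unfolding fun_alg_def by auto

lemma fun_alg_compl:
  assumes "fun_alg A" "f \<in> A"
  shows "(\<lambda>x. 1 - f x) \<in> A"
proof -
  have "(\<lambda>x. 1 + (- 1) * f x) \<in> A"
    using fun_algD[OF assms(1)] assms(2) by blast
  then show ?thesis by simp
qed

lemma fun_alg_sum: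
  fixes n :: nat
  assumes "fun_alg A" "\<And>i. i < n \<Longrightarrow> f i \<in> A"
  shows "(\<lambda>x. \<Sum>i<n. f i x) \<in> A"
  using assms(2) by (induction n) (auto intro: fun_algD[OF assms(1)])

lemma fun_alg_prod:
  fixes n :: nat
  assumes "fun_alg A" "\<And>i. i < n \<Longrightarrow> f i \<in> A"
  shows "(\<lambda>x. \<Prod>i<n. f i x) \<in> A"
  using assms(2) by (induction n) (auto intro: fun_algD[OF assms(1)])

lemma fun_alg_pw_limits:
  assumes "fun_alg A"
  shows "fun_alg (pw_limits A)"
  unfolding fun_alg_def
proof (intro conjI allI ballI)
  show "(\<lambda>x. c) \<in> pw_limits A" for c
    using fun_algD(1)[OF assms] subset_pw_limits by blast
  fix f g assume "f \<in> pw_limits A" "g \<in> pw_limits A"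
  then obtain fs gs where fs: "\<And>n. fs n \<in> A" "pw_limit fs f" and gs: "\<And>n. gs n \<in> A" "pw_limit gs g"
    unfolding pw_limits_def by blast
  have "pw_limit (\<lambda>n x. fs n x + gs n x) (\<lambda>x. f x + g x)"
    "pw_limit (\<lambda>n x. fs n x * gs n x) (\<lambda>x. f x * g x)"
    using fs gs unfolding pw_limit_def by (auto intro: tendsto_add tendsto_mult)
  moreover have "\<forall>n. (\<lambda>x. fs n x + gs n x) \<in> A" "\<forall>n. (\<lambda>x. fs n x * gs n x) \<in> A"
    using fun_algD(2,3)[OF assms fs(1) gs(1)] by simp_all
  ultimately show "(\<lambda>x. f x + g x) \<in> pw_limits A" "(\<lambda>x. f x * g x) \<in> pw_limits A"
    unfolding pw_limits_def mem_Collect_eq by (fast intro: exI)+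
qed

lemma fun_alg_continuous: "fun_alg {f. continuous_map X euclideanreal f}"
  unfolding fun_alg_def by (auto intro: continuous_map_add continuous_map_real_mult)

text \<open>A closed set is a decreasing intersection of open sets \<open>C n\<close>. Urysohn
  functions equal to 1 on \<open>P\<close> and 0 off \<open>C n\<close> agree with the indicator at
  each point from some index on.\<close>

lemma closedin_ev_limits:
  assumes X: "metrizable_space X" "topspace X = UNIV" and P: "closedin X P"
  shows "indicator P \<in> ev_limits {f. continuous_map X euclideanreal f}"
proof -
  obtain C :: "nat \<Rightarrow> 'a set" where C: "\<And>n. openin X (C n)" "\<And>n. C (Suc n) \<subseteq> C n" "\<Inter> (range C) = P"
    using closed_imp_gdelta_in[OF X(1) P] unfolding gdelta_in_descending by blast
  have "\<exists>f. continuous_map X euclideanreal f \<and> f ` P \<subseteq> {1::real} \<and> f ` (- C n) \<subseteq> {0}" for n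
  proof -
    have "closedin X (- C n)"
      using C(1)[of n] X(2) openin_closedin[of "C n" X] by (simp add: Compl_eq_Diff_UNIV)
    moreover have "disjnt P (- C n)"
      using C(3) by (auto simp: disjnt_iff)
    ultimately show ?thesis
      using Urysohn_lemma_alt[OF metrizable_imp_normal_space[OF X(1)] P] by metis
  qed
  then obtain f where f: "\<And>n. continuous_map X euclideanreal (f n)" "\<And>n. f n ` P \<subseteq> {1::real}"
      "\<And>n. f n ` (- C n) \<subseteq> {0}"
    by metis
  have "\<forall>\<^sub>F n in sequentially. f n x = indicator P x" for x
  proof (cases "x \<in> P")
    case True
    then have "f n x = 1" for n
      using f(2)[of n] by blast
    then show ?thesis
      using True by simp
  next
    case False
    then obtain m where m: "x \<notin> C m"
      using C(3) by blast
    have "f n x = 0" if "n \<ge> m" for n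
    proof -
      have "C n \<subseteq> C m"
        using lift_Suc_antimono_le[of C, OF C(2) that] .
      then show ?thesis
        using m f(3)[of n] by blast
    qed
    then show ?thesis
      using False by (auto simp: eventually_sequentially)
  qed
  then show ?thesis
    unfolding ev_limits_def using f(1) by blast
qed

text \<open>The products in \<open>F\<close> make the cover disjoint inside the algebra. If
  \<open>k\<close> is the first index with x \<in> P k, then once \<open>p i m x\<close> is exact
  for all i \<le> k, the terms before \<open>k\<close> vanish and the factor
  \<open>1 - p k m x\<close> kills all terms after it.\<close>

lemma const_on_cover_pw_limits:
  fixes P :: "nat \<Rightarrow> 'a set"
  assumes A: "fun_alg A" and P: "\<And>i. indicator (P i) \<in> ev_limits A" "(\<Union>i. P i) = UNIV"
    and f: "\<And>i x y. x \<in> P i \<Longrightarrow> y \<in> P i \<Longrightarrow> f x = f y"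
  shows "f \<in> pw_limits A"
proof -
  obtain p where p: "\<And>i n. p i n \<in> A"
      and ev: "\<And>i x. \<forall>\<^sub>F n in sequentially. p i n x = indicator (P i) x"
    using P(1) unfolding ev_limits_def by simp metis
  \<comment> \<open>The value of \<open>f\<close> on \<open>P i\<close>; it is arbitrary when
    \<open>P i\<close> is empty, and then no point takes its limit value from it.\<close>
  define c where "c i = f (SOME x. x \<in> P i)" for i
  have c: "f x = c i" if "x \<in> P i" for x i
    unfolding c_def using f[OF that someI[of "\<lambda>x. x \<in> P i", OF that]] .
  define F where "F m x = (\<Sum>i<m. c i * (p i m x * (\<Prod>j<i. 1 - p j m x)))" for m x
  have "F m \<in> A" for m
    unfolding F_def
    by (intro fun_alg_sum fun_alg_prod fun_algD[OF A] A fun_alg_compl p)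
  moreover have "pw_limit F f"
    unfolding pw_limit_def
  proof (intro allI tendsto_eventually)
    fix x
    obtain k where k: "x \<in> P k" "\<And>j. j < k \<Longrightarrow> x \<notin> P j"
      using P(2) exists_least_iff[of "\<lambda>i. x \<in> P i"] by blast
    have "\<forall>\<^sub>F m in sequentially. \<forall>i\<in>{..k}. p i m x = indicator (P i) x"
      by (intro eventually_ball_finite ballI ev) simp
    then show "\<forall>\<^sub>F m in sequentially. F m x = f x"
      using eventually_gt_at_top[of k]
    proof eventually_elim
      fix m assume m: "\<forall>i\<in>{..k}. p i m x = indicator (P i) x" "k < m"
      have 0: "p j m x = 0" if "j < k" for j
        using m(1) k(2)[OF that] that by simp
      have 1: "p k m x = 1"
        using m(1) k(1) by simp
      have "c i * (p i m x * (\<Prod>j<i. 1 - p j m x)) = (if i = k then c k else 0)" for i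
      proof (cases i k rule: linorder_cases)
        case less
        then show ?thesis using 0 by simp
      next
        case equal
        then show ?thesis using 0 1 by simp
      next
        case greater
        then have "(\<Prod>j<i. 1 - p j m x) = 0"
          using 1 by (intro prod_zero) auto
        then show ?thesis using greater by simp
      qed
      then have "F m x = c k"
        unfolding F_def using m(2) by simp
      then show "F m x = f x"
        using c[OF k(1)] by simp
    qed
  qed
  ultimately show ?thesis
    unfolding pw_limits_def by blast
qed

section \<open>The Baire classes and their link with the Borel classes\<close>

context Polish_ordinal
begin

definition Bai :: "'o set \<Rightarrow> ('a \<Rightarrow> real) set" where
  "Bai I = baire_step T I (wo_rec r (baire_step T))"

definition Bai_below :: "'o set \<Rightarrow> ('a \<Rightarrow> real) set" where
  "Bai_below I = (\<Union>b\<in>I. Bai (wo_below r b))"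

lemma baire_class_eq: "baire_class T r = Bai (Field r)"
  unfolding baire_class_def Bai_def wo_top_def ..

lemma wo_rec_baire: "wo_rec r (baire_step T) b = Bai (wo_below r b)"
  unfolding Bai_def by (rule wo_rec_eq[OF wo]) (auto simp: baire_step_def)

lemma Bai_empty: "Bai {} = {f. continuous_map T euclideanreal f}"
  unfolding Bai_def by (simp add: baire_step_def)

lemma Bai_nonempty: "I \<noteq> {} \<Longrightarrow> Bai I = pw_limits (Bai_below I)"
  unfolding Bai_def[of I] baire_step_def wo_rec_baire pw_limits_def Bai_below_def by simp

lemma continuous_subset_Bai:
  assumes "is_seg r I"
  shows "{f. continuous_map T euclideanreal f} \<subseteq> Bai I"
  using wo assms
proof (induction I rule: seg_induct)
  case (seg I)
  show ?case
  proof (cases "I = {}")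
    case False
    then obtain b where "b \<in> I" by blast
    then have "{f. continuous_map T euclideanreal f} \<subseteq> Bai_below I"
      using seg.IH unfolding Bai_below_def by blast
    then show ?thesis
      using subset_pw_limits Bai_nonempty[OF False] by blast
  qed (simp add: Bai_empty)
qed

lemma Bai_mono:
  assumes "is_seg r J" "I \<subseteq> J"
  shows "Bai I \<subseteq> Bai J"
proof (cases "I = {}")
  case True
  then show ?thesis
    using continuous_subset_Bai[OF assms(1)] by (simp add: Bai_empty)
next
  case False
  then have "J \<noteq> {}" using assms(2) by blast
  have "Bai_below I \<subseteq> Bai_below J"
    unfolding Bai_below_def using assms(2) by blast
  then show ?thesis
    unfolding Bai_nonempty[OF False] Bai_nonempty[OF \<open>J \<noteq> {}\<close>] pw_limits_def by blast
qed

text \<open>Two functions from the union lie in a common class because segments are comparable. The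
  closure of the lower classes is a hypothesis here since it is the induction hypothesis of
  \<open>fun_alg_Bai\<close>.\<close>

lemma fun_alg_Bai_below_aux:
  assumes "I \<noteq> {}" "\<And>b. b \<in> I \<Longrightarrow> fun_alg (Bai (wo_below r b))"
  shows "fun_alg (Bai_below I)"
  unfolding fun_alg_def
proof (intro conjI allI ballI)
  show "(\<lambda>x. c) \<in> Bai_below I" for c
    using assms fun_algD(1) unfolding Bai_below_def by blast
  fix f g assume "f \<in> Bai_below I" "g \<in> Bai_below I"
  then obtain b c where bc: "b \<in> I" "f \<in> Bai (wo_below r b)" "c \<in> I" "g \<in> Bai (wo_below r c)"
    unfolding Bai_below_def by blast
  have "\<exists>d\<in>I. f \<in> Bai (wo_below r d) \<and> g \<in> Bai (wo_below r d)"
    using is_seg_linear[OF wo seg_below seg_below, of b c]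
  proof
    assume "wo_below r b \<subseteq> wo_below r c"
    then show ?thesis
      using bc Bai_mono[OF seg_below] by blast
  next
    assume "wo_below r c \<subseteq> wo_below r b"
    then show ?thesis
      using bc Bai_mono[OF seg_below] by blast
  qed
  then obtain d where d: "d \<in> I" "f \<in> Bai (wo_below r d)" "g \<in> Bai (wo_below r d)"
    by blast
  show "(\<lambda>x. f x + g x) \<in> Bai_below I" "(\<lambda>x. f x * g x) \<in> Bai_below I"
    using fun_algD(2,3)[OF assms(2)[OF d(1)] d(2,3)] d(1) unfolding Bai_below_def by blast+
qed

lemma fun_alg_Bai:
  assumes "is_seg r I"
  shows "fun_alg (Bai I)"
  using wo assms
proof (induction I rule: seg_induct)
  case (seg I)
  then show ?case
    using fun_alg_continuous[of T] fun_alg_Bai_below_aux[of I] fun_alg_pw_limits[of "Bai_below I"]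
    by (cases "I = {}") (auto simp: Bai_empty Bai_nonempty)
qed

lemma fun_alg_Bai_below: "I \<noteq> {} \<Longrightarrow> fun_alg (Bai_below I)"
  using fun_alg_Bai_below_aux fun_alg_Bai seg_below by blast

text \<open>If \<open>V\<close> is the union of the sets \<open>- S n\<close>, the indicator of
  \<open>- V\<close> is the eventual value of finite products of the indicators of the
  \<open>S n\<close>, and by induction these belong to lower Baire classes. At order type 1 the set
  \<open>- V\<close> is closed and Urysohn functions serve.\<close>

lemma Sig_Compl_ev_limits:
  assumes "is_seg r I" "I \<noteq> {}" "V \<in> Sig I"
  shows "indicator (- V) \<in> ev_limits (Bai_below I)"
  using wo assms
proof (induction I arbitrary: V rule: seg_induct)
  case (seg I)
  show ?case
  proof (cases "big I")
    case True
    obtain S b where b: "\<And>n::nat. b n \<in> I" "\<And>n. wo_below r (b n) \<noteq> {}"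
        and S: "\<And>n. S n \<in> Sig (wo_below r (b n))" "V = (\<Union>n. - S n)"
      using Sig_bigE[OF True seg.prems(2)] by metis
    define \<phi> where "\<phi> m x = (\<Prod>n<m. 1 - indicator (- S n) x :: real)" for m x
    have "indicator (- S n) \<in> Bai_below I" for n
    proof -
      have "indicator (- S n) \<in> Bai (wo_below r (b n))"
        using seg.IH[OF b S(1)] ev_limits_subset Bai_nonempty[OF b(2)] by blast
      then show ?thesis
        using b(1) unfolding Bai_below_def by blast
    qed
    then have "\<phi> m \<in> Bai_below I" for m
      unfolding \<phi>_def by (intro fun_alg_prod fun_alg_compl fun_alg_Bai_below seg.prems)
    moreover have "\<forall>\<^sub>F m in sequentially. \<phi> m x = indicator (- V) x" for x
    proof (cases "x \<in> V")
      case True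
      then obtain n where n: "x \<notin> S n"
        using S(2) by blast
      have "\<phi> m x = 0" if "m > n" for m
        unfolding \<phi>_def using n that by (intro prod_zero bexI[of _ n]) auto
      then show ?thesis
        using True by (intro eventually_mono[OF eventually_gt_at_top[of n]]) simp
    next
      case False
      then have "\<phi> m x = 1" for m
        unfolding \<phi>_def S(2) by simp
      then show ?thesis
        using False by simp
    qed
    ultimately show ?thesis
      unfolding ev_limits_def by blast
  next
    case False
    then obtain b where "I = {b}"
      using seg.prems(1) unfolding big_def by blast
    then have "wo_below r b = {}"
      using seg.hyps unfolding is_seg_def wo_below_def by auto
    then have "Bai_below I = {f. continuous_map T euclideanreal f}"
      using \<open>I = {b}\<close> by (simp add: Bai_below_def Bai_empty)
    moreover have "closedin T (- V)"
      using False seg.prems(2) top openin_closedin[of V T] by (simp add: Sig_small Compl_eq_Diff_UNIV)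
    ultimately show ?thesis
      using closedin_ev_limits[OF Polish_top_imp_metrizable[OF polish] top] by simp
  qed
qed

text \<open>Splitting the F-sigma sets gives a countable cover by \<open>T'\<close>-closed sets on
  which \<open>f\<close> is constant. Their indicators are eventual limits both of
  \<open>T'\<close>-continuous functions and, being indicators of complements of
  \<open>Sig (Field r)\<close> sets, of functions of lower Baire class for \<open>T\<close>; each
  view gives one conclusion.\<close>

lemma const_on_fsigma_cover_baire:
  assumes I: "Field r \<noteq> {}" and T': "refines (Field r) T'"
    and C: "countable \<C>" "\<Union>\<C> = UNIV" "\<And>C. C \<in> \<C> \<Longrightarrow> fsigma_in T' C"
    and f: "\<And>C x y. C \<in> \<C> \<Longrightarrow> x \<in> C \<Longrightarrow> y \<in> C \<Longrightarrow> f x = f y"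
  shows "f \<in> baire_one T'" "f \<in> baire_class T r"
proof -
  have T1: "metrizable_space T'" "topspace T' = UNIV" "{U. openin T' U} \<subseteq> Sig (Field r)"
    using T' Polish_top_imp_metrizable unfolding refines_def by auto
  have "\<exists>\<D>. countable \<D> \<and> (\<forall>D\<in>\<D>. closedin T' D) \<and> \<Union>\<D> = C" if "C \<in> \<C>" for C
    using C(3)[OF that] unfolding fsigma_in_def union_of_def by auto
  then obtain \<D> where D: "\<And>C. C \<in> \<C> \<Longrightarrow> countable (\<D> C)" "\<And>C D. C \<in> \<C> \<Longrightarrow> D \<in> \<D> C \<Longrightarrow> closedin T' D"
      "\<And>C. C \<in> \<C> \<Longrightarrow> \<Union>(\<D> C) = C"
    by metis
  let ?E = "\<Union> (\<D> ` \<C>)"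
  have cE: "countable ?E"
    using C(1) D(1) by blast
  have UE: "\<Union> ?E = UNIV"
  proof -
    have "x \<in> \<Union> ?E" for x
    proof -
      obtain C where "C \<in> \<C>" "x \<in> C"
        using C(2) by (metis UNIV_I UnionE)
      moreover from this obtain D where "D \<in> \<D> C" "x \<in> D"
        using D(3)[of C] by (metis UnionE)
      ultimately show ?thesis
        by (meson UN_I UnionI)
    qed
    then show ?thesis by blast
  qed
  then have neE: "?E \<noteq> {}"
    by (metis Union_empty UNIV_not_empty)
  define P where "P = from_nat_into ?E"
  have Pr: "range P = ?E"
    unfolding P_def using range_from_nat_into[OF neE cE] .
  have P_in: "P i \<in> ?E" for i
    using Pr by blast
  have P_UN: "(\<Union>i. P i) = UNIV"
    using Pr UE by simp
  have P_cl: "closedin T' (P i)" for i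
    using P_in[of i] D(2) by blast
  have P_const: "f x = f y" if "x \<in> P i" "y \<in> P i" for i x y
  proof -
    obtain C where "C \<in> \<C>" "P i \<in> \<D> C"
      using P_in[of i] by blast
    then show ?thesis
      using f[of C x y] D(3)[of C] that by blast
  qed
  have "f \<in> pw_limits {f. continuous_map T' euclideanreal f}"
    by (rule const_on_cover_pw_limits[OF fun_alg_continuous closedin_ev_limits[OF T1(1,2) P_cl] P_UN P_const])
  then show "f \<in> baire_one T'"
    unfolding baire_one_def pw_limits_def by simp
  have "indicator (P i) \<in> ev_limits (Bai_below (Field r))" for i
  proof -
    have "- P i \<in> Sig (Field r)"
      using P_cl[of i] T1(2,3) by (auto simp: closedin_def Compl_eq_Diff_UNIV)
    then show ?thesis
      using Sig_Compl_ev_limits[OF is_seg_Field I] by fastforce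
  qed
  then have "f \<in> pw_limits (Bai_below (Field r))"
    by (rule const_on_cover_pw_limits[OF fun_alg_Bai_below[OF I] _ P_UN P_const])
  then show "f \<in> baire_class T r"
    unfolding baire_class_eq Bai_nonempty[OF I] .
qed

end

section \<open>Universal sets\<close>

text \<open>Deleting from \<open>F\<close> every basic open part that meets it in a countable set
  leaves uncountably many condensation points. Small closed balls about two of them cut uncountable
  pieces out of \<open>F\<close>.\<close>

lemma (in Metric_space) uncountable_split:
  assumes sc: "second_countable mtopology" and F: "closedin mtopology F" "uncountable F" and "e > 0"
  shows "\<exists>S. (\<forall>b. closedin mtopology (S b) \<and> uncountable (S b) \<and> S b \<subseteq> F \<and> (\<exists>a. S b \<subseteq> mcball a e)) \<and>
    S True \<inter> S False = {}"
proof -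
  have FM: "F \<subseteq> M"
    using F(1) closedin_subset by fastforce
  obtain \<B> where B: "countable \<B>" "\<And>V. V \<in> \<B> \<Longrightarrow> openin mtopology V"
      "\<And>U x. openin mtopology U \<Longrightarrow> x \<in> U \<Longrightarrow> \<exists>V\<in>\<B>. x \<in> V \<and> V \<subseteq> U"
    using sc unfolding second_countable_def by metis
  define N where "N = (\<Union>V\<in>{V \<in> \<B>. countable (V \<inter> F)}. V \<inter> F)"
  have "countable N"
    unfolding N_def using B(1) by (intro countable_UN) auto
  then have unc: "uncountable (F - N)"
    using uncountable_minus_countable[OF F(2)] by blast
  then obtain p where p: "p \<in> F - N"
    by (metis countable_empty ex_in_conv)
  have "\<not> F - N \<subseteq> {p}"
    using unc by (meson countable_finite finite.emptyI finite.insertI finite_subset)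
  then obtain q where q: "q \<in> F - N" "q \<noteq> p"
    by blast
  have pq: "p \<in> M" "q \<in> M"
    using p q FM by auto
  define c where "c b = (if b then p else q)" for b
  \<comment> \<open>A third of the distance keeps the two closed balls disjoint.\<close>
  define \<delta> where "\<delta> = min e (d p q / 3)"
  have dpq: "d p q > 0"
    using pq q(2) by simp
  then have \<delta>: "\<delta> > 0" "\<delta> \<le> e" "\<delta> \<le> d p q / 3"
    unfolding \<delta>_def using \<open>e > 0\<close> by auto
  have c: "c b \<in> F - N" "c b \<in> M" for b
    unfolding c_def using p q pq by auto
  define S where "S b = F \<inter> mcball (c b) \<delta>" for b
  have "uncountable (S b)" for b
  proof
    assume cS: "countable (S b)"
    have "openin mtopology (mball (c b) \<delta>)" "c b \<in> mball (c b) \<delta>"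
      using c(2) \<delta>(1) by auto
    then obtain V where V: "V \<in> \<B>" "c b \<in> V" "V \<subseteq> mball (c b) \<delta>"
      using B(3) by meson
    have "V \<inter> F \<subseteq> S b"
      unfolding S_def using V(3) mball_subset_mcball by blast
    then have "countable (V \<inter> F)"
      using cS countable_subset by blast
    then have "c b \<in> N"
      unfolding N_def using V(1,2) c(1)[of b] by blast
    then show False
      using c(1)[of b] by blast
  qed
  moreover have "closedin mtopology (S b)" for b
    unfolding S_def using F(1) by (intro closedin_Int) auto
  moreover have "S True \<inter> S False = {}"
  proof (rule ccontr)
    assume "S True \<inter> S False \<noteq> {}"
    then obtain x where x: "x \<in> mcball p \<delta>" "x \<in> mcball q \<delta>"
      unfolding S_def c_def by (metis Int_iff disjoint_iff)
    then have "d p q \<le> d p x + d q x"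
      using triangle[of p x q] pq commute[of x q] by auto
    then show False
      using x \<delta>(3) dpq by auto
  qed
  moreover have "\<exists>a. S b \<subseteq> mcball a e" for b
    by (rule exI[of _ "c b"]) (use \<delta>(2) in \<open>auto simp: S_def\<close>)
  moreover have "S b \<subseteq> F" for b
    unfolding S_def by blast
  ultimately show ?thesis
    by (intro exI[of _ S]) simp
qed

text \<open>A Cantor scheme of closed uncountable sets \<open>Fs l\<close> is built by repeated
  splitting, and \<open>K n b\<close> is the finite union of the sets of level n+1 whose last choice
  is \<open>b\<close>. Completeness gives a point on every branch, so the pairs serve as digits by
  which points code arbitrary binary sequences.\<close>

lemma Cantor_pairs:
  assumes T: "Polish_top T" "topspace T = (UNIV :: 'a set)" and unc: "uncountable (UNIV :: 'a set)"
  obtains K :: "nat \<Rightarrow> bool \<Rightarrow> 'a set" where "\<And>n b. closedin T (K n b)"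
    "\<And>n. K n True \<inter> K n False = {}" "\<And>y. \<exists>x. \<forall>n. x \<in> K n (y n)"
proof -
  obtain M d where "Metric_space M d" and mc: "Metric_space.mcomplete M d" and X: "T = Metric_space.mtopology M d"
    using T(1) unfolding Polish_top_def completely_metrizable_space_def by blast
  then interpret Metric_space M d by blast
  have M: "M = UNIV"
    using T(2) X by simp
  have sc: "second_countable mtopology"
    using Polish_top_imp_second_countable[OF T(1)] X by simp
  define good where "good F \<longleftrightarrow> closedin mtopology F \<and> uncountable F" for F
  define spl where "spl n F S \<longleftrightarrow> (\<forall>b. good (S b) \<and> S b \<subseteq> F \<and> (\<exists>a. S b \<subseteq> mcball a (1 / real (Suc n)))) \<and>
      S True \<inter> S False = {}" for n F S
  have "\<exists>S. spl n F S" if "good F" for n F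
    using uncountable_split[OF sc, of F "1 / real (Suc n)"] that unfolding good_def spl_def
    by (simp add: conj_assoc)
  moreover define S where "S n F = (SOME S. spl n F S)" for n F
  ultimately have S0: "spl n F (S n F)" if "good F" for n F
    using that by (simp add: someI_ex)
  have S: "good (S n F b)" "S n F b \<subseteq> F" "\<exists>a. S n F b \<subseteq> mcball a (1 / real (Suc n))"
    "S n F True \<inter> S n F False = {}" if "good F" for n F b
    using S0[OF that, of n] unfolding spl_def by simp_all
  \<comment> \<open>The newest choice stands at the head of the list, so \<open>length l\<close> is
    the level at which \<open>Fs l\<close> is split.\<close>
  define Fs where "Fs = rec_list M (\<lambda>b l F. S (length l) F b)"
  have Fs [simp]: "Fs [] = M" "Fs (b # l) = S (length l) (Fs l) b" for b l
    unfolding Fs_def by simp_all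
  have good: "good (Fs l)" for l
  proof (induction l)
    case Nil
    show ?case
      using unc closedin_topspace[of mtopology] unfolding good_def by (simp add: M[symmetric])
  next
    case (Cons b l)
    then show ?case
      using S(1) by simp
  qed
  have disj: "Fs l \<inter> Fs l' = {}" if "length l = length l'" "l \<noteq> l'" for l l'
    using that
  proof (induction l l' rule: list_induct2)
    case (Cons b l b' l')
    show ?case
    proof (cases "l = l'")
      case True
      then have "b' = (\<not> b)"
        using Cons.prems by auto
      then show ?thesis
        using True S(4)[OF good[of l]] by (cases b) auto
    next
      case False
      then show ?thesis
        using Cons S(2)[OF good[of l]] S(2)[OF good[of l']] by fastforce
    qed
  qed simp
  define K where "K n b = (\<Union>l\<in>{l. length l = n}. Fs (b # l))" for n b
  show thesis
  proof
    have "finite {l :: bool list. length l = n}" for n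
      using finite_lists_length_eq[of "UNIV :: bool set" n] by simp
    then show "closedin T (K n b)" for n b
      unfolding K_def X using good unfolding good_def by (intro closedin_Union) (auto simp del: Fs)
    show "K n True \<inter> K n False = {}" for n
    proof -
      have "Fs (True # l) \<inter> Fs (False # l') = {}" if "length l = n" "length l' = n" for l l'
        using that by (intro disj) auto
      then show ?thesis
        unfolding K_def by blast
    qed
    fix y :: "nat \<Rightarrow> bool"
    \<comment> \<open>The first \<open>n\<close> digits of \<open>y\<close>, reversed to match the
      order of choices in \<open>Fs\<close>.\<close>
    define L where "L n = rev (map y [0..<n])" for n
    have L: "L (Suc n) = y n # L n" "length (L n) = n" for n
      unfolding L_def by simp_all
    have dec: "decseq (\<lambda>n. Fs (L n))"
      by (rule decseq_SucI) (simp add: L S(2)[OF good])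
    have small: "\<exists>n a. Fs (L n) \<subseteq> mcball a \<epsilon>" if \<epsilon>: "\<epsilon> > 0" for \<epsilon>
    proof -
      obtain n where n: "1 / real (Suc n) < \<epsilon>"
        using nat_approx_posE[OF \<epsilon>] by blast
      obtain a where a: "Fs (L (Suc n)) \<subseteq> mcball a (1 / real (Suc n))"
        using S(3)[OF good[of "L n"], of n "y n"] by (auto simp: L)
      have "mcball a (1 / real (Suc n)) \<subseteq> mcball a \<epsilon>"
        using n by (intro mcball_subset_concentric) simp
      then show ?thesis
        using a by blast
    qed
    have "\<Inter> (range (\<lambda>n. Fs (L n))) \<noteq> {}"
      using mc[unfolded mcomplete_nest, rule_format, of "\<lambda>n. Fs (L n)"] dec small good
      unfolding good_def by (metis countable_empty)
    then obtain x where x: "\<And>n. x \<in> Fs (L n)"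
      by blast
    have "x \<in> K n (y n)" for n
      using x[of "Suc n"] unfolding K_def L(1) using L(2) by blast
    then show "\<exists>x. \<forall>n. x \<in> K n (y n)"
      by blast
  qed
qed

section \<open>Universal sets for the additive classes and the diagonal sequence\<close>

context Polish_ordinal
begin

text \<open>One half of the continuity of a code that varies with the point: for each digit, the
  points of \<open>C\<close> where it is true form a relatively open set.\<close>

definition rel_open_coords :: "'a set \<Rightarrow> ('a \<Rightarrow> nat \<Rightarrow> bool) \<Rightarrow> bool" where
  "rel_open_coords C p \<longleftrightarrow> (\<forall>n. \<exists>V. openin T V \<and> {x \<in> C. p x n} = C \<inter> V)"

text \<open>Open sets are coded by sets of basic open sets, higher ones by codes for sequences of
  sets of lower class. The second conjunct takes the place of a universal set in the product of code
  space and \<open>X\<close>: substituting a code that varies with the point gives a set of the same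
  class relative to \<open>C\<close>.\<close>

lemma Sig_universal:
  assumes "is_seg r I" "countable I"
  shows "\<exists>u :: (nat \<Rightarrow> bool) \<Rightarrow> 'a set. Sig I \<subseteq> range u \<and>
    (\<forall>p. rel_open_coords C p \<longrightarrow> (\<exists>V\<in>Sig I. {x \<in> C. x \<in> u (p x)} = C \<inter> V))"
  using wo assms
proof (induction I rule: seg_induct)
  case (seg I)
  show ?case
  proof (cases "big I")
    case False
    obtain \<B> where B: "countable \<B>" "\<And>V. V \<in> \<B> \<Longrightarrow> openin T V"
      "\<And>U x. openin T U \<Longrightarrow> x \<in> U \<Longrightarrow> \<exists>V\<in>\<B>. x \<in> V \<and> V \<subseteq> U"
      using Polish_top_imp_second_countable[OF polish] unfolding second_countable_def by metis
    define Q where "Q = from_nat_into (insert {} \<B>)"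
    have Qr: "range Q = insert {} \<B>"
      unfolding Q_def using B(1) by (intro range_from_nat_into) auto
    have Qop: "openin T (Q n)" for n
    proof -
      have "Q n \<in> insert {} \<B>"
        using Qr by blast
      then show ?thesis
        using B(2) by auto
    qed
    define u where "u y = (\<Union>n\<in>{n. y n}. Q n)" for y
    have "V \<in> range u" if V: "openin T V" for V
    proof -
      have "V \<subseteq> u (\<lambda>n. Q n \<subseteq> V)"
      proof
        fix x assume "x \<in> V"
        then obtain W where W: "W \<in> \<B>" "x \<in> W" "W \<subseteq> V"
          using B(3) V by blast
        then obtain n where "W = Q n"
          using Qr by (metis insertCI rangeE)
        then show "x \<in> u (\<lambda>n. Q n \<subseteq> V)"
          unfolding u_def using W by auto
      qed
      moreover have "u (\<lambda>n. Q n \<subseteq> V) \<subseteq> V"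
        unfolding u_def by blast
      ultimately show ?thesis by blast
    qed
    moreover have "\<exists>V\<in>Sig I. {x \<in> C. x \<in> u (p x)} = C \<inter> V" if p: "rel_open_coords C p" for p
    proof -
      obtain V where V: "\<And>n. openin T (V n)" "\<And>n. {x \<in> C. p x n} = C \<inter> V n"
        using p unfolding rel_open_coords_def by metis
      have "{x \<in> C. x \<in> u (p x)} = (\<Union>n. {x \<in> C. p x n} \<inter> Q n)"
        unfolding u_def by blast
      also have "\<dots> = C \<inter> (\<Union>n. V n \<inter> Q n)"
        unfolding V(2) by blast
      finally show ?thesis
        using False V(1) Qop
        by (intro bexI[of _ "\<Union>n. V n \<inter> Q n"]) (auto simp: Sig_small intro!: openin_Union openin_Int)
    qed
    ultimately show ?thesis
      using False by (intro exI[of _ u]) (auto simp: Sig_small)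
  next
    case True
    define J where "J = {b \<in> I. wo_below r b \<noteq> {}}"
    have J: "J \<noteq> {}" "countable J"
      using big_nonzero[OF seg.hyps True] countable_subset[OF _ seg.prems, of J] unfolding J_def by blast+
    define e where "e = from_nat_into J"
    have er: "range e = J"
      unfolding e_def using range_from_nat_into[OF J] .
    have eJ: "e m \<in> I" "wo_below r (e m) \<noteq> {}" for m
      using er unfolding J_def by blast+
    define univ where "univ m u \<longleftrightarrow> Sig (wo_below r (e m)) \<subseteq> range u \<and>
      (\<forall>p. rel_open_coords C p \<longrightarrow> (\<exists>V\<in>Sig (wo_below r (e m)). {x \<in> C. x \<in> u (p x)} = C \<inter> V))"
      for m and u :: "(nat \<Rightarrow> bool) \<Rightarrow> 'a set"
    have "\<exists>u. univ m u" for m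
      unfolding univ_def
    proof (rule seg.IH[OF eJ(1)])
      have "wo_below r (e m) \<subseteq> I"
        using seg.hyps eJ(1) unfolding is_seg_def by blast
      then show "countable (wo_below r (e m))"
        using seg.prems countable_subset by blast
    qed
    then obtain u where "\<And>m. univ m (u m)"
      by metis
    then have u: "\<And>m. Sig (wo_below r (e m)) \<subseteq> range (u m)"
          "\<And>m p. rel_open_coords C p \<Longrightarrow> \<exists>V\<in>Sig (wo_below r (e m)). {x \<in> C. x \<in> u m (p x)} = C \<inter> V"
      unfolding univ_def by simp_all
    \<comment> \<open>The code is split into slots (m, k), with infinitely many slots for each lower
      index \<open>e m\<close>, since a set may use the same lower class repeatedly.\<close>
    define v where "v y = (\<Union>m k. - u m (\<lambda>j. y (prod_encode (m, prod_encode (k, j)))))"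
      for y :: "nat \<Rightarrow> bool"
    have "V \<in> range v" if V: "V \<in> Sig I" for V
    proof -
      obtain S b where b: "\<And>n::nat. b n \<in> I" "\<And>n. wo_below r (b n) \<noteq> {}"
        and S: "\<And>n. S n \<in> Sig (wo_below r (b n))" "V = (\<Union>n. - S n)"
        using Sig_bigE[OF True V] by metis
      \<comment> \<open>Slot (m, k) holds \<open>S k\<close> if \<open>e m\<close> is its index; all
        other slots hold \<open>UNIV\<close>, whose complement adds nothing to the union.\<close>
      have "\<exists>y. u m y = (if e m = b k then S k else UNIV)" for m k
      proof -
        have "(if e m = b k then S k else UNIV) \<in> Sig (wo_below r (e m))"
          using S(1)[of k] UNIV_Sig[OF seg_below] by auto
        then show ?thesis
          using u(1)[of m] by (metis rangeE subsetD)
      qed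
      then obtain y where y: "\<And>m k. u m (y m k) = (if e m = b k then S k else UNIV)"
        by metis
      define z where "z i = (case prod_decode i of (m, i') \<Rightarrow> case prod_decode i' of (k, j) \<Rightarrow> y m k j)" for i
      have "v z = (\<Union>m k. - u m (y m k))"
        unfolding v_def z_def by simp
      also have "\<dots> = V"
      proof (rule antisym)
        show "(\<Union>m k. - u m (y m k)) \<subseteq> V"
          unfolding y S(2) by (auto split: if_splits)
        show "V \<subseteq> (\<Union>m k. - u m (y m k))"
        proof
          fix x assume "x \<in> V"
          then obtain k where k: "x \<notin> S k"
            using S(2) by blast
          obtain m where "e m = b k"
            using er b[of k] unfolding J_def by (metis (mono_tags, lifting) mem_Collect_eq rangeE)
          then have "x \<notin> u m (y m k)"
            using k by (simp add: y)
          then show "x \<in> (\<Union>m k. - u m (y m k))"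
            by blast
        qed
      qed
      finally show ?thesis by blast
    qed
    moreover have "\<exists>V\<in>Sig I. {x \<in> C. x \<in> v (p x)} = C \<inter> V" if p: "rel_open_coords C p" for p
    proof -
      have "rel_open_coords C (\<lambda>x j. p x (prod_encode (m, prod_encode (k, j))))" for m k
        using p unfolding rel_open_coords_def by blast
      then have "\<exists>V\<in>Sig (wo_below r (e m)). {x \<in> C. x \<in> u m (\<lambda>j. p x (prod_encode (m, prod_encode (k, j))))} = C \<inter> V" for m k
        by (rule u(2))
      then obtain V where V: "\<And>m k. V m k \<in> Sig (wo_below r (e m))"
          "\<And>m k. {x \<in> C. x \<in> u m (\<lambda>j. p x (prod_encode (m, prod_encode (k, j))))} = C \<inter> V m k"
        by metis
      have "(\<Union>m k. - V m k) \<in> Sig I"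
        using Sig_Compl[OF True eJ V(1)] by (intro Sig_UN)
      moreover have "{x \<in> C. x \<in> v (p x)} = (\<Union>m k. C - {x \<in> C. x \<in> u m (\<lambda>j. p x (prod_encode (m, prod_encode (k, j))))})"
        unfolding v_def by blast
      then have "{x \<in> C. x \<in> v (p x)} = C \<inter> (\<Union>m k. - V m k)"
        unfolding V(2) by blast
      ultimately show ?thesis by blast
    qed
    ultimately show ?thesis
      by (intro exI[of _ v]) auto
  qed
qed

text \<open>A point of \<open>C\<close> codes a whole sequence of codes, and \<open>S n\<close>
  tests the point against the set given by its own n-th code. Given any sequence \<open>B\<close>, a
  point that codes all the \<open>B n\<close> at once is the required one.\<close>

lemma Sig_diagonal:
  assumes unc: "uncountable (UNIV :: 'a set)" and r: "countable (Field r)" "big (Field r)"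
  obtains S :: "nat \<Rightarrow> 'a set" where "\<And>n. S n \<in> Sig (Field r)"
    "\<And>B. (\<And>n. B n \<in> Sig (Field r)) \<Longrightarrow> \<exists>x. \<forall>n. x \<in> S n \<longleftrightarrow> x \<in> B n"
proof -
  obtain K :: "nat \<Rightarrow> bool \<Rightarrow> 'a set" where K: "\<And>n b. closedin T (K n b)"
    "\<And>n. K n True \<inter> K n False = {}" "\<And>y. \<exists>x. \<forall>n. x \<in> K n (y n)"
    using Cantor_pairs[OF polish top unc] by metis
  define C where "C = (\<Inter>n. K n True \<union> K n False)"
  have Ccl: "closedin T C"
    unfolding C_def using K(1) by (intro closedin_Inter) auto
  have CS: "C \<in> Sig (Field r)"
  proof -
    obtain b where b: "b \<in> Field r" "wo_below r b \<noteq> {}"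
      using big_nonzero[OF is_seg_Field r(2)] .
    have "- C \<in> Sig (wo_below r b)"
      using Ccl top openin_subset_Sig[OF seg_below] by (auto simp: closedin_def Compl_eq_Diff_UNIV)
    then show ?thesis
      using Sig_Compl[OF r(2) b] by fastforce
  qed
  define \<pi> where "\<pi> x n \<longleftrightarrow> x \<in> K n True" for x n
  obtain u :: "(nat \<Rightarrow> bool) \<Rightarrow> 'a set" where "Sig (Field r) \<subseteq> range u \<and>
      (\<forall>p. rel_open_coords C p \<longrightarrow> (\<exists>V\<in>Sig (Field r). {x \<in> C. x \<in> u (p x)} = C \<inter> V))"
    using Sig_universal[OF is_seg_Field r(1), of C] by (rule exE)
  then have u: "Sig (Field r) \<subseteq> range u"
    "\<And>p. rel_open_coords C p \<Longrightarrow> \<exists>V\<in>Sig (Field r). {x \<in> C. x \<in> u (p x)} = C \<inter> V"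
    by simp_all
  define S where "S n = {x \<in> C. x \<in> u (\<lambda>j. \<pi> x (prod_encode (n, j)))}" for n
  show thesis
  proof
    fix n
    have "rel_open_coords C (\<lambda>x j. \<pi> x (prod_encode (n, j)))"
      unfolding rel_open_coords_def
    proof
      fix j
      let ?i = "prod_encode (n, j)"
      \<comment> \<open>On \<open>C\<close> a digit is true exactly when the closed set for false is
        avoided, which is an open condition.\<close>
      have "openin T (- K ?i False)"
        using K(1)[of ?i False] top by (simp add: closedin_def Compl_eq_Diff_UNIV)
      moreover have "{x \<in> C. \<pi> x ?i} = C \<inter> - K ?i False"
        using K(2)[of ?i] unfolding \<pi>_def C_def by blast
      ultimately show "\<exists>V. openin T V \<and> {x \<in> C. \<pi> x ?i} = C \<inter> V"
        by blast
    qed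
    then obtain V where "V \<in> Sig (Field r)" "S n = C \<inter> V"
      using u(2) unfolding S_def by blast
    then show "S n \<in> Sig (Field r)"
      using Sig_Int[OF is_seg_Field CS] by simp
  next
    fix B :: "nat \<Rightarrow> 'a set" assume B: "\<And>n. B n \<in> Sig (Field r)"
    have "\<exists>y. u y = B n" for n
      using u(1) B[of n] by (metis rangeE subsetD)
    then obtain y where y: "\<And>n. u (y n) = B n"
      by metis
    define z where "z i = case_prod y (prod_decode i)" for i
    obtain x where x: "\<And>n. x \<in> K n (z n)"
      using K(3) by blast
    have "x \<in> K n True \<union> K n False" for n
      using x[of n] by (cases "z n") auto
    then have xC: "x \<in> C"
      unfolding C_def by blast
    have "\<pi> x n = z n" for n
      using x[of n] K(2)[of n] unfolding \<pi>_def by (cases "z n") auto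
    then have "(\<lambda>j. \<pi> x (prod_encode (n, j))) = y n" for n
      unfolding z_def by simp
    then have "x \<in> S n \<longleftrightarrow> x \<in> B n" for n
      unfolding S_def using xC y by simp
    then show "\<exists>x. \<forall>n. x \<in> S n \<longleftrightarrow> x \<in> B n"
      by blast
  qed
qed

end

section \<open>Ordinal powers of omega\<close>

lemma omega_exp_cases:
  assumes "(h, k) \<in> omega_exp s" "h \<noteq> k"
  obtains z where "z \<in> Field s" "h z < k z" "\<And>w. (z, w) \<in> s \<Longrightarrow> w \<noteq> z \<Longrightarrow> h w = k w"
proof -
  obtain z where z: "z \<in> Field s" "h z < k z" "\<forall>w\<in>Field s. (z, w) \<in> s \<and> w \<noteq> z \<longrightarrow> h w = k w"
    using assms unfolding omega_exp_def by auto
  have "h w = k w" if "(z, w) \<in> s" "w \<noteq> z" for w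
    using z(3) that FieldI2 by fastforce
  then show thesis
    using that z by blast
qed

lemma omega_expI:
  assumes "h \<in> fin_supp s" "k \<in> fin_supp s" "z \<in> Field s" "h z < k z"
    and "\<And>w. (z, w) \<in> s \<Longrightarrow> w \<noteq> z \<Longrightarrow> h w = k w"
  shows "(h, k) \<in> omega_exp s"
  using assms unfolding omega_exp_def by blast

lemma fin_suppD: "h \<in> fin_supp s \<Longrightarrow> finite {z. h z > 0}" "h \<in> fin_supp s \<Longrightarrow> h z \<noteq> 0 \<Longrightarrow> z \<in> Field s"
  unfolding fin_supp_def by auto

text \<open>Reading exponents as multiplicities, \<open>\<omega>\<^sup>\<zeta>\<close> embeds into the multiset order over \<open>\<zeta>\<close>.\<close>
lemma omega_exp_mult:
  assumes s: "Well_order s" and hk: "(h, k) \<in> omega_exp s" "h \<noteq> k"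
  shows "(Abs_multiset h, Abs_multiset k) \<in> mult (s - Id)"
proof -
  have fs: "h \<in> fin_supp s" "k \<in> fin_supp s"
    using hk(1) unfolding omega_exp_def by auto
  have cnt: "count (Abs_multiset h) = h" "count (Abs_multiset k) = k"
    using fin_suppD(1)[OF fs(1)] fin_suppD(1)[OF fs(2)] by (simp_all add: Abs_multiset_inverse)
  obtain z where z: "z \<in> Field s" "h z < k z" "\<And>w. (z, w) \<in> s \<Longrightarrow> w \<noteq> z \<Longrightarrow> h w = k w"
    using omega_exp_cases[OF hk] by blast
  let ?H = "Abs_multiset h" and ?K = "Abs_multiset k"
  let ?C = "?H \<inter># ?K"
  have "(?C + (?H - ?C), ?C + (?K - ?C)) \<in> mult (s - Id)"
  proof (rule one_step_implies_mult)
    have zK: "z \<in># ?K - ?C"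
      using z(2) by (simp add: in_diff_count cnt)
    then show "?K - ?C \<noteq> {#}" by auto
    show "\<forall>w \<in># ?H - ?C. \<exists>j \<in># ?K - ?C. (w, j) \<in> s - Id"
    proof
      fix w assume "w \<in># ?H - ?C"
      then have w: "k w < h w"
        by (simp add: in_diff_count cnt min_def split: if_splits)
      then have "w \<noteq> z" "(z, w) \<notin> s" "w \<in> Field s"
        using z fin_suppD(2)[OF fs(1)] by fastforce+
      then have "(w, z) \<in> s - Id"
        using s z(1) by (auto simp: well_order_on_def linear_order_on_def total_on_def)
      then show "\<exists>j \<in># ?K - ?C. (w, j) \<in> s - Id"
        using zK by blast
    qed
  qed
  moreover have "?C + (?H - ?C) = ?H" "?C + (?K - ?C) = ?K"
    by (rule subset_mset.add_diff_inverse, simp)+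
  ultimately show ?thesis
    by (simp only:)
qed

lemma wf_omega_exp:
  assumes "Well_order s"
  shows "wf (omega_exp s - Id)"
proof (rule wf_subset)
  have "wf (s - Id)"
    using assms by (simp add: well_order_on_def)
  then show "wf (inv_image (mult (s - Id)) Abs_multiset)"
    by (intro wf_inv_image wf_mult)
  show "omega_exp s - Id \<subseteq> inv_image (mult (s - Id)) Abs_multiset"
    using omega_exp_mult[OF assms] by (auto simp: inv_image_def)
qed

lemma Field_omega_exp: "Field (omega_exp s) = fin_supp s"
proof -
  have "(h, h) \<in> omega_exp s" if "h \<in> fin_supp s" for h
    using that by (simp add: omega_exp_def)
  moreover have "omega_exp s \<subseteq> fin_supp s \<times> fin_supp s"
    by (auto simp: omega_exp_def)
  ultimately show ?thesis
    unfolding Field_def by blast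
qed

text \<open>Two finitely supported functions differ at finitely many points. The largest of these
  decides the comparison; it is found as a minimal element for the converse order, which is
  well-founded on a finite set.\<close>

lemma total_omega_exp:
  assumes s: "Well_order s" and hk: "h \<in> fin_supp s" "k \<in> fin_supp s"
  shows "(h, k) \<in> omega_exp s \<or> (k, h) \<in> omega_exp s"
proof (cases "h = k")
  case True
  then show ?thesis using hk by (simp add: omega_exp_def)
next
  case False
  let ?D = "{z. h z \<noteq> k z}"
  have "?D \<subseteq> {z. h z > 0} \<union> {z. k z > 0}"
    by auto
  then have fin: "finite ?D"
    using fin_suppD(1)[OF hk(1)] fin_suppD(1)[OF hk(2)] by (meson finite_UnI finite_subset)
  have ne: "?D \<noteq> {}"
    using False by auto
  have sub: "?D \<subseteq> Field s"
  proof
    fix z assume "z \<in> ?D"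
    then have "h z \<noteq> 0 \<or> k z \<noteq> 0" by auto
    then show "z \<in> Field s"
      using fin_suppD(2)[OF hk(1)] fin_suppD(2)[OF hk(2)] by blast
  qed
  have "acyclic (s - Id)"
    using s wf_acyclic by (auto simp: well_order_on_def)
  then have "wf ((s - Id)\<inverse> \<inter> ?D \<times> ?D)"
    using fin by (intro finite_acyclic_wf) (auto intro: acyclic_subset simp: acyclic_converse)
  then obtain z where z: "z \<in> ?D" "\<And>w. (w, z) \<in> (s - Id)\<inverse> \<inter> ?D \<times> ?D \<Longrightarrow> w \<notin> ?D"
    using ne by (metis (no_types, lifting) ex_in_conv wfE_min)
  have *: "h w = k w" if "(z, w) \<in> s" "w \<noteq> z" for w
    using z that by auto
  have "h z < k z \<or> k z < h z"
    using z(1) by auto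
  then show ?thesis
  proof
    assume "h z < k z"
    then show ?thesis
      using omega_expI[OF hk, of z] sub z(1) * by blast
  next
    assume "k z < h z"
    then show ?thesis
      using omega_expI[OF hk(2,1), of z] sub z(1) *[symmetric] by blast
  qed
qed

text \<open>Antisymmetry and transitivity follow from well-foundedness, the latter also using
  totality: a failure of either would give a cycle.\<close>

lemma Well_order_omega_exp:
  assumes s: "Well_order s"
  shows "Well_order (omega_exp s)"
proof -
  let ?W = "omega_exp s"
  have wf: "wf (?W - Id)"
    by (rule wf_omega_exp[OF s])
  have refl: "refl_on (fin_supp s) ?W" and sub: "?W \<subseteq> fin_supp s \<times> fin_supp s"
    by (auto simp: refl_on_def omega_exp_def)
  have anti: "antisym ?W"
  proof (rule antisymI, rule ccontr)
    fix h k assume "(h, k) \<in> ?W" "(k, h) \<in> ?W" "h \<noteq> k"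
    then show False
      using wf_not_sym[OF wf, of h k] by auto
  qed
  have "trans ?W"
  proof (rule transI, rule ccontr)
    fix h k l assume hk: "(h, k) \<in> ?W" and kl: "(k, l) \<in> ?W" and n: "(h, l) \<notin> ?W"
    then have lh: "(l, h) \<in> ?W"
      using total_omega_exp[OF s, of h l] sub by blast
    have "h \<noteq> k" "k \<noteq> l" "l \<noteq> h"
      using hk kl lh n refl sub by (auto simp: refl_on_def)
    then have "(h, h) \<in> (?W - Id)\<^sup>+"
      using hk kl lh by (meson DiffI pair_in_Id_conv trancl.simps)
    then show False
      using wf_acyclic[OF wf] unfolding acyclic_def by blast
  qed
  then show ?thesis
    using anti refl sub wf total_omega_exp[OF s] unfolding Field_omega_exp well_order_on_def linear_order_on_def
      partial_order_on_def preorder_on_def total_on_def by blast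
qed

text \<open>A finitely supported function is determined by the finite part of its graph over its
  support.\<close>

lemma countable_omega_exp:
  assumes "countable (Field s)"
  shows "countable (Field (omega_exp s))"
proof -
  let ?g = "\<lambda>h. {(z, h z) | z. h z \<noteq> (0::nat)}"
  have "?g ` fin_supp s \<subseteq> {A. finite A \<and> A \<subseteq> Field s \<times> UNIV}"
  proof
    fix A assume "A \<in> ?g ` fin_supp s"
    then obtain h where h: "h \<in> fin_supp s" "A = ?g h"
      by blast
    have "A = (\<lambda>z. (z, h z)) ` {z. h z > 0}"
      using h(2) by auto
    then show "A \<in> {A. finite A \<and> A \<subseteq> Field s \<times> UNIV}"
      using fin_suppD[OF h(1)] by auto
  qed
  moreover have "countable {A. finite A \<and> A \<subseteq> Field s \<times> (UNIV :: nat set)}"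
    using assms by (intro countable_Collect_finite_subset) auto
  ultimately have "countable (?g ` fin_supp s)"
    using countable_subset by blast
  moreover have "inj_on ?g (fin_supp s)"
  proof (rule inj_onI, rule ext)
    fix h k z assume e: "?g h = ?g k"
    have "(z, n) \<in> ?g h \<longleftrightarrow> n = h z \<and> n \<noteq> 0" "(z, n) \<in> ?g k \<longleftrightarrow> n = k z \<and> n \<noteq> 0" for n
      by auto
    then have "n = h z \<and> n \<noteq> 0 \<longleftrightarrow> n = k z \<and> n \<noteq> 0" for n
      unfolding e by blast
    then show "h z = k z"
      by (metis (full_types))
  qed
  ultimately show ?thesis
    unfolding Field_omega_exp by (rule countable_image_inj_on)
qed

text \<open>Raising any one coefficient gives a larger element; thus a power of omega with nonzero
  exponent is a limit ordinal.\<close>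

lemma omega_exp_no_max:
  assumes "Field s \<noteq> {}" "h \<in> Field (omega_exp s)"
  shows "\<exists>k\<in>Field (omega_exp s). h \<in> wo_below (omega_exp s) k"
proof -
  obtain z where z: "z \<in> Field s"
    using assms(1) by blast
  let ?k = "h(z := Suc (h z))"
  have h: "h \<in> fin_supp s"
    using assms(2) by (simp add: Field_omega_exp)
  have "{w. ?k w \<noteq> 0} \<subseteq> insert z {w. h w > 0}"
    by auto
  then have "finite {w. ?k w \<noteq> 0}"
    using fin_suppD(1)[OF h] by (meson finite_insert finite_subset)
  then have k: "?k \<in> fin_supp s"
    using fin_suppD(2)[OF h] z unfolding fin_supp_def by auto
  have "h \<noteq> ?k"
    by (metis fun_upd_same n_not_Suc_n)
  moreover have "(h, ?k) \<in> omega_exp s"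
    using h k z unfolding omega_exp_def by auto
  ultimately show ?thesis
    using k unfolding Field_omega_exp wo_below_def by blast
qed

section \<open>The oscillation rank\<close>

lemma osc_rec_eq:
  assumes "Well_order W"
  shows "wo_rec W (osc_deriv_step T f \<epsilon>) a =
    topspace T \<inter> (\<Inter>c\<in>wo_below W a. osc_step T f \<epsilon> (wo_rec W (osc_deriv_step T f \<epsilon>) c))"
proof -
  have "wo_rec W (osc_deriv_step T f \<epsilon>) a =
      osc_deriv_step T f \<epsilon> (wo_below W a) (wo_rec W (osc_deriv_step T f \<epsilon>))"
    by (rule wo_rec_eq[OF assms]) (simp add: osc_deriv_step_def)
  then show ?thesis
    by (simp add: osc_deriv_step_def)
qed

lemma osc_deriv_eq:
  "osc_deriv T f \<epsilon> W =
    topspace T \<inter> (\<Inter>c\<in>Field W. osc_step T f \<epsilon> (wo_rec W (osc_deriv_step T f \<epsilon>) c))"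
  unfolding osc_deriv_def wo_top_def by (simp add: osc_deriv_step_def)

lemma osc_step_not_const:
  assumes "x \<in> osc_step T f \<epsilon> F" "openin T U" "x \<in> U"
    and small: "\<And>y z. y \<in> F \<inter> U \<Longrightarrow> z \<in> F \<inter> U \<Longrightarrow> \<bar>f y - f z\<bar> < \<epsilon>"
  shows False
proof -
  obtain y z where "y \<in> F \<inter> U" "z \<in> F \<inter> U" "\<epsilon> \<le> \<bar>f y - f z\<bar>"
    using assms(1-3) unfolding osc_step_def by blast
  then show False
    using small[of y z] by linarith
qed

text \<open>If the derivatives of an indicator function vanish at the order type of \<open>W\<close>, membership in
  the set is decided at the first stage where the function becomes locally constant.\<close>
lemma osc_deriv_empty_stages:
  assumes W: "Well_order W" and top: "topspace T = UNIV"
    and empty: "osc_deriv T (indicator A) 1 W = {}"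
  obtains B where "\<And>c b. openin T (B c b)"
    "\<And>x. \<exists>\<eta>\<in>Field W. (\<forall>c\<in>wo_below W \<eta>. \<forall>b. x \<notin> B c b) \<and> x \<in> B \<eta> (x \<in> A) \<and> x \<notin> B \<eta> (x \<notin> A)"
proof -
  define G where "G = wo_rec W (osc_deriv_step T (indicator A) 1)"
  have G: "G a = (\<Inter>c\<in>wo_below W a. osc_step T (indicator A) 1 (G c))" for a
    unfolding G_def by (subst osc_rec_eq[OF W]) (simp add: top)
  \<comment> \<open>Open sets on which membership in \<open>A\<close> is constant within the
    derivative \<open>G c\<close>. Both values of \<open>b\<close> are possible at points with a
    neighbourhood missing \<open>G c\<close>, so only the first stage reached by a point is
    informative.\<close>
  define B where "B c b = \<Union>{U. openin T U \<and> (\<forall>y\<in>G c \<inter> U. y \<in> A \<longleftrightarrow> b)}" for c b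
  show thesis
  proof
    show "openin T (B c b)" for c b
      unfolding B_def by blast
    fix x
    have "\<exists>c\<in>Field W. x \<notin> osc_step T (indicator A) 1 (G c)"
      using empty unfolding osc_deriv_eq G_def[symmetric] top by blast
    then obtain c where c: "c \<in> Field W" "x \<notin> osc_step T (indicator A) 1 (G c)"
      by blast
    \<comment> \<open>The first stage whose derivative loses \<open>x\<close>; minimality keeps
      \<open>x\<close> in \<open>G \<eta>\<close>.\<close>
    have "\<exists>\<eta>\<in>Field W. x \<notin> osc_step T (indicator A) 1 (G \<eta>) \<and>
        (\<forall>c\<in>wo_below W \<eta>. x \<in> osc_step T (indicator A) 1 (G c))"
      using W c
    proof (induction c rule: wo_less_induct)
      case (less c)
      show ?case
      proof (cases "\<forall>d\<in>wo_below W c. x \<in> osc_step T (indicator A) 1 (G d)")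
        case False
        then obtain d where "d \<in> wo_below W c" "x \<notin> osc_step T (indicator A) 1 (G d)"
          by blast
        then show ?thesis
          using less.IH[of d] wo_below_FieldD by fast
      qed (use less.prems in blast)
    qed
    then obtain \<eta> where \<eta>: "\<eta> \<in> Field W" "x \<notin> osc_step T (indicator A) 1 (G \<eta>)"
        "\<And>c. c \<in> wo_below W \<eta> \<Longrightarrow> x \<in> osc_step T (indicator A) 1 (G c)"
      by blast
    have xG: "x \<in> G \<eta>"
      using \<eta>(3) by (subst G) blast
    have below: "x \<notin> B c b" if c: "c \<in> wo_below W \<eta>" for c b
    proof
      assume "x \<in> B c b"
      then obtain U where U: "openin T U" "x \<in> U" "\<And>y. y \<in> G c \<inter> U \<Longrightarrow> y \<in> A \<longleftrightarrow> b"
        unfolding B_def by blast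
      show False
      proof (rule osc_step_not_const[OF \<eta>(3)[OF c] U(1,2)])
        show "\<bar>indicator A y - indicator A z :: real\<bar> < 1" if "y \<in> G c \<inter> U" "z \<in> G c \<inter> U" for y z
          using U(3)[OF that(1)] U(3)[OF that(2)] by (simp add: indicator_def)
      qed
    qed
    obtain U where U: "openin T U" "x \<in> U"
        "\<And>y z. y \<in> G \<eta> \<inter> U \<Longrightarrow> z \<in> G \<eta> \<inter> U \<Longrightarrow> \<not> 1 \<le> \<bar>indicator A y - indicator A z :: real\<bar>"
      using \<eta>(2) xG unfolding osc_step_def by blast
    have "y \<in> A \<longleftrightarrow> x \<in> A" if "y \<in> G \<eta> \<inter> U" for y
      using U(3)[OF that, of x] xG U(2) by (cases "y \<in> A"; cases "x \<in> A") (simp_all add: indicator_def)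
    then have "x \<in> B \<eta> (x \<in> A)"
      unfolding B_def using U(1,2) by blast
    moreover have "x \<notin> B \<eta> (x \<notin> A)"
      unfolding B_def using xG by blast
    ultimately show "\<exists>\<eta>\<in>Field W. (\<forall>c\<in>wo_below W \<eta>. \<forall>b. x \<notin> B c b) \<and> x \<in> B \<eta> (x \<in> A) \<and> x \<notin> B \<eta> (x \<notin> A)"
      using \<eta>(1) below by blast
  qed
qed

text \<open>The situation after refinement, when all the sets involved are open.
  \<open>S c True\<close> and \<open>S c False\<close> are the votes of stage \<open>c\<close> for
  and against membership in the set \<open>A\<close>; each point of \<open>U n\<close> receives a
  vote no later than stage \<open>e n\<close>.\<close>

locale stratification =
  fixes T :: "'a topology" and W :: "'w rel" and S :: "'w \<Rightarrow> bool \<Rightarrow> 'a set"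
    and U :: "nat \<Rightarrow> 'a set" and e :: "nat \<Rightarrow> 'w"
  assumes metrizable: "metrizable_space T" and top: "topspace T = UNIV"
    and W: "Well_order W" "countable (Field W)" "Field W \<noteq> {}"
    and no_max: "\<And>a. a \<in> Field W \<Longrightarrow> \<exists>b\<in>Field W. a \<in> wo_below W b"
    and open_S: "\<And>c b. c \<in> Field W \<Longrightarrow> openin T (S c b)"
    and disj_S: "\<And>c. c \<in> Field W \<Longrightarrow> S c True \<inter> S c False = {}"
    and open_U: "\<And>n. openin T (U n)"
    and disj_U: "\<And>m n. m \<noteq> n \<Longrightarrow> U m \<inter> U n = {}"
    and e: "\<And>n. e n \<in> Field W"
    and U_stage: "\<And>n x. x \<in> U n \<Longrightarrow> \<exists>c\<in>insert (e n) (wo_below W (e n)). \<exists>b. x \<in> S c b"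
    and S_subset: "\<And>c b. c \<in> Field W \<Longrightarrow> S c b \<subseteq> (\<Union>n. U n)"
begin

text \<open>The points that have received no vote before stage \<open>c\<close>.\<close>

definition low :: "'w \<Rightarrow> 'a set" where
  "low c = {x. \<forall>d\<in>wo_below W c. \<forall>b. x \<notin> S d b}"

text \<open>The earliest vote decides; points without any vote stay outside.\<close>

definition A :: "'a set" where
  "A = {x. \<exists>c\<in>Field W. x \<in> S c True \<and> x \<in> low c}"

text \<open>Unspecified outside the union of the \<open>U n\<close>, where \<open>f\<close> and
  \<open>g\<close> vanish.\<close>

definition idx :: "'a \<Rightarrow> nat" where
  "idx x = (THE n. x \<in> U n)"

definition f :: "'a \<Rightarrow> real" where
  "f x = indicator A x / (real (idx x) + 1)"

definition g :: "'a \<Rightarrow> real" where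
  "g x = (if x \<in> (\<Union>n. U n) then real (idx x) + 1 else 0)"

lemma idx_eq: "x \<in> U n \<Longrightarrow> idx x = n"
  unfolding idx_def using disj_U by (intro the_equality) blast+

lemma A_subset: "A \<subseteq> (\<Union>n. U n)"
  unfolding A_def using S_subset by blast

lemma f_times_g: "f x * g x = indicator A x"
proof (cases "x \<in> A")
  case True
  then have "x \<in> (\<Union>n. U n)"
    using A_subset by blast
  then show ?thesis
    using True unfolding f_def g_def by simp
qed (simp add: f_def)

text \<open>The first stage voting on \<open>x\<close> is unique, and at that stage the two votes
  are disjoint.\<close>

lemma A_iff:
  assumes c: "c \<in> Field W" "x \<in> S c b" "x \<in> low c"
  shows "x \<in> A \<longleftrightarrow> b"
proof
  assume "x \<in> A"
  then obtain d where d: "d \<in> Field W" "x \<in> S d True" "x \<in> low d"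
    unfolding A_def by blast
  have "d \<notin> wo_below W c" "c \<notin> wo_below W d"
    using c d unfolding low_def by blast+
  then have "c = d"
    using wo_below_notin_iff[OF W(1) c(1) d(1)] by blast
  then show b
    using d c disj_S[OF c(1)] by (cases b) auto
next
  assume b
  then show "x \<in> A"
    unfolding A_def using c by auto
qed

lemma first_stage:
  assumes "c \<in> Field W" "x \<in> S c b"
  obtains d b' where "d \<in> insert c (wo_below W c)" "x \<in> S d b'" "x \<in> low d"
proof -
  have "\<exists>d\<in>insert c (wo_below W c). \<exists>b'. x \<in> S d b' \<and> x \<in> low d"
    using W(1) assms
  proof (induction c arbitrary: b rule: wo_less_induct)
    case (less c)
    show ?case
    proof (cases "x \<in> low c")
      case False
      then obtain d b' where d: "d \<in> wo_below W c" "x \<in> S d b'"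
        unfolding low_def by blast
      moreover have "d \<in> Field W"
        using d(1) wo_below_FieldD by fast
      ultimately obtain d' b'' where "d' \<in> insert d (wo_below W d)" "x \<in> S d' b''" "x \<in> low d'"
        using less.IH by blast
      moreover from this have "d' \<in> wo_below W c"
        using d(1) wo_below_trans[OF W(1)] by blast
      ultimately show ?thesis by blast
    qed (use less.prems in blast)
  qed
  then show thesis
    using that by blast
qed

text \<open>If \<open>x\<close> had a vote before \<open>a\<close>, let \<open>c\<close> be its
  first stage. By induction the points of the derivative at \<open>c\<close> that lie in the open
  set \<open>U n \<inter> S c b\<close> also lie in \<open>low c\<close>, so \<open>h\<close> is
  constant on them and \<open>x\<close> is lost before \<open>a\<close>.\<close>

lemma osc_rec_inter_U:
  assumes h: "\<And>n c b x y. c \<in> Field W \<Longrightarrow> x \<in> U n \<inter> S c b \<inter> low c \<Longrightarrow> y \<in> U n \<inter> S c b \<inter> low c \<Longrightarrow> h x = h y"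
    and "\<epsilon> > 0"
  shows "wo_rec W (osc_deriv_step T h \<epsilon>) a \<inter> U n \<subseteq> low a"
  using W(1)
proof (induction a rule: wo_less_induct)
  case (less a)
  let ?D = "wo_rec W (osc_deriv_step T h \<epsilon>)"
  show ?case
  proof (rule subsetI, rule ccontr)
    fix x assume x: "x \<in> ?D a \<inter> U n" and "x \<notin> low a"
    then obtain c0 b0 where c0: "c0 \<in> wo_below W a" "x \<in> S c0 b0"
      unfolding low_def by blast
    then have "c0 \<in> Field W"
      using wo_below_FieldD by fast
    then obtain c b where c: "c \<in> insert c0 (wo_below W c0)" "x \<in> S c b" "x \<in> low c"
      using first_stage c0(2) by metis
    have ca: "c \<in> wo_below W a"
      using c(1) c0(1) wo_below_trans[OF W(1)] by blast
    then have cW: "c \<in> Field W"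
      using wo_below_FieldD by fast
    have "x \<in> osc_step T h \<epsilon> (?D c)"
      using x ca by (subst (asm) osc_rec_eq[OF W(1)]) blast
    moreover have "openin T (U n \<inter> S c b)"
      using open_U open_S[OF cW] by blast
    moreover have "x \<in> U n \<inter> S c b"
      using x c by blast
    moreover have "\<bar>h y - h z\<bar> < \<epsilon>" if "y \<in> ?D c \<inter> (U n \<inter> S c b)" "z \<in> ?D c \<inter> (U n \<inter> S c b)" for y z
    proof -
      have "y \<in> low c" "z \<in> low c"
        using less.IH[OF ca] that by blast+
      then have "h y = h z"
        using that h[OF cW, of y n b z] by blast
      then show ?thesis
        using \<open>\<epsilon> > 0\<close> by simp
    qed
    ultimately show False
      by (rule osc_step_not_const)
  qed
qed

lemma f_const:
  assumes "c \<in> Field W" "x \<in> U n \<inter> S c b \<inter> low c" "y \<in> U n \<inter> S c b \<inter> low c"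
  shows "f x = f y"
proof -
  have "x \<in> A \<longleftrightarrow> y \<in> A" "idx x = idx y"
    using A_iff[OF assms(1)] idx_eq assms(2,3) by auto
  then show ?thesis
    unfolding f_def by (simp add: indicator_def)
qed

lemma finite_bound:
  assumes "finite F" "F \<subseteq> Field W"
  shows "\<exists>a\<in>Field W. \<forall>c\<in>F. c \<in> wo_below W a"
  using assms
proof (induction F rule: finite_induct)
  case empty
  then show ?case using W(3) by blast
next
  case (insert c F)
  then obtain a where a: "a \<in> Field W" "\<forall>c\<in>F. c \<in> wo_below W a"
    by blast
  show ?case
  proof (cases "c \<in> wo_below W a")
    case True
    then show ?thesis using a by blast
  next
    case False
    then have ac: "a = c \<or> a \<in> wo_below W c"
      using wo_below_notin_iff[OF W(1), of c a] a insert.prems by blast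
    obtain d where d: "d \<in> Field W" "c \<in> wo_below W d"
      using no_max insert.prems by blast
    then have "a \<in> wo_below W d"
      using ac wo_below_trans[OF W(1)] by blast
    then show ?thesis
      using a d wo_below_trans[OF W(1)] by blast
  qed
qed

text \<open>Finitely many stages \<open>e n\<close> are bounded strictly below the limit ordinal
  \<open>W\<close>, so some derivative misses the sets \<open>U n\<close> with n \<le> N. There
  \<open>f\<close> takes values between 0 and 1/(N+1), which is less than \<epsilon>, and one more
  derivative is empty.\<close>

lemma beta_le_f: "beta_le T f W"
  unfolding beta_le_def
proof (intro allI impI)
  fix \<epsilon> :: real assume \<epsilon>: "\<epsilon> > 0"
  let ?D = "wo_rec W (osc_deriv_step T f \<epsilon>)"
  obtain N where N: "1 / real (Suc N) < \<epsilon>"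
    using nat_approx_posE[OF \<epsilon>] by blast
  obtain a where a: "a \<in> Field W" "\<And>n. n \<le> N \<Longrightarrow> e n \<in> wo_below W a"
    using finite_bound[of "e ` {..N}"] e by auto
  have D: "x \<notin> U n" if x: "x \<in> ?D a" and n: "n \<le> N" for x n
  proof
    assume xU: "x \<in> U n"
    have "?D a \<inter> U n \<subseteq> low a"
      by (rule osc_rec_inter_U[OF _ \<epsilon>]) (rule f_const)
    then have "x \<in> low a"
      using x xU by blast
    moreover obtain c b where "c \<in> insert (e n) (wo_below W (e n))" "x \<in> S c b"
      using U_stage[OF xU] by blast
    moreover from this have "c \<in> wo_below W a"
      using a(2)[OF n] wo_below_trans[OF W(1)] by blast
    ultimately show False
      unfolding low_def by blast
  qed
  have bound: "0 \<le> f x \<and> f x \<le> 1 / real (Suc N)" if x: "x \<in> ?D a" for x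
  proof (cases "x \<in> A")
    case True
    then obtain n where n: "x \<in> U n"
      using A_subset by blast
    then have "N < n"
      using D[OF x] by (meson not_le)
    then have "1 / (real n + 1) \<le> 1 / real (Suc N)"
      by (intro divide_left_mono) auto
    then show ?thesis
      using True idx_eq[OF n] unfolding f_def by simp
  qed (simp add: f_def)
  show "osc_deriv T f \<epsilon> W = {}"
  proof (rule ccontr)
    assume "osc_deriv T f \<epsilon> W \<noteq> {}"
    then obtain x where "x \<in> osc_step T f \<epsilon> (?D a)"
      using a(1) unfolding osc_deriv_eq by blast
    moreover have "openin T UNIV"
      using openin_topspace[of T] top by simp
    moreover have "\<bar>f y - f z\<bar> < \<epsilon>" if "y \<in> ?D a \<inter> UNIV" "z \<in> ?D a \<inter> UNIV" for y z
      using bound[of y] bound[of z] that N by auto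
    ultimately show False
      using osc_step_not_const[of x T f \<epsilon> "?D a" UNIV] by blast
  qed
qed

text \<open>On each open \<open>U n\<close> the function is constant, so one derivative removes
  their union; \<open>g\<close> is zero on what remains, and a second derivative leaves nothing.
  Unboundedness of \<open>g\<close> does no harm.\<close>

lemma beta_le_g: "beta_le T g W"
  unfolding beta_le_def
proof (intro allI impI)
  fix \<epsilon> :: real assume \<epsilon>: "\<epsilon> > 0"
  let ?D = "wo_rec W (osc_deriv_step T g \<epsilon>)"
  obtain c where c: "c \<in> Field W"
    using W(3) by blast
  obtain a where a: "a \<in> Field W" "c \<in> wo_below W a"
    using no_max[OF c] by blast
  have g0: "g x = 0" if x: "x \<in> ?D a" for x
  proof -
    have xs: "x \<in> osc_step T g \<epsilon> (?D c)"
      using x a(2) by (subst (asm) osc_rec_eq[OF W(1)]) blast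
    have "x \<notin> U n" for n
    proof
      assume "x \<in> U n"
      moreover have "\<bar>g y - g z\<bar> < \<epsilon>" if "y \<in> ?D c \<inter> U n" "z \<in> ?D c \<inter> U n" for y z
      proof -
        have "g y = real n + 1" "g z = real n + 1"
          using that idx_eq unfolding g_def by auto
        then show ?thesis using \<epsilon> by simp
      qed
      ultimately show False
        using osc_step_not_const[OF xs open_U] by blast
    qed
    then show ?thesis
      unfolding g_def by simp
  qed
  show "osc_deriv T g \<epsilon> W = {}"
  proof (rule ccontr)
    assume "osc_deriv T g \<epsilon> W \<noteq> {}"
    then obtain x where "x \<in> osc_step T g \<epsilon> (?D a)"
      using a(1) unfolding osc_deriv_eq by blast
    moreover have "openin T UNIV"
      using openin_topspace[of T] top by simp
    moreover have "\<bar>g y - g z\<bar> < \<epsilon>" if "y \<in> ?D a \<inter> UNIV" "z \<in> ?D a \<inter> UNIV" for y z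
      using g0[of y] g0[of z] that \<epsilon> by auto
    ultimately show False
      using osc_step_not_const[of x T g \<epsilon> "?D a" UNIV] by blast
  qed
qed

text \<open>The complement of all \<open>U n\<close>, and the parts of \<open>U n\<close> decided at
  stage \<open>c\<close> by vote \<open>b\<close>: a countable cover by F-sigma sets on which
  \<open>f\<close> and \<open>g\<close> are both constant.\<close>

definition pieces :: "'a set set" where
  "pieces = insert (- (\<Union>n. U n)) ((\<lambda>(n, c, b). U n \<inter> S c b \<inter> low c) ` (UNIV \<times> Field W \<times> UNIV))"

lemma countable_pieces: "countable pieces"
  unfolding pieces_def using W(2) by (intro countable_insert countable_image countable_SIGMA) auto

lemma Union_pieces: "\<Union>pieces = UNIV"
proof -
  have "x \<in> \<Union>pieces" for x
  proof (cases "x \<in> (\<Union>n. U n)")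
    case True
    then obtain n where n: "x \<in> U n" by blast
    then obtain c0 b0 where c0: "c0 \<in> insert (e n) (wo_below W (e n))" "x \<in> S c0 b0"
      using U_stage by blast
    then have "c0 \<in> Field W"
      using e wo_below_FieldD by fast
    then obtain c b where c: "c \<in> insert c0 (wo_below W c0)" "x \<in> S c b" "x \<in> low c"
      using first_stage c0(2) by metis
    then have "c \<in> Field W"
      using \<open>c0 \<in> Field W\<close> wo_below_FieldD by fast
    then have "U n \<inter> S c b \<inter> low c \<in> pieces"
      unfolding pieces_def by (intro insertI2 image_eqI[of _ _ "(n, c, b)"]) auto
    then show ?thesis
      using n c by blast
  qed (auto simp: pieces_def)
  then show ?thesis by blast
qed

lemma closedin_low: "closedin T (low c)"
proof -
  have "openin T (\<Union>d\<in>wo_below W c. \<Union>b. S d b)"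
    using open_S wo_below_subset_Field[of W c] by (intro openin_Union) blast
  moreover have "low c = topspace T - (\<Union>d\<in>wo_below W c. \<Union>b. S d b)"
    unfolding low_def top by blast
  ultimately show ?thesis
    using openin_closedin_eq by fastforce
qed

lemma fsigma_pieces:
  assumes "C \<in> pieces"
  shows "fsigma_in T C"
proof -
  have "closedin T (- (\<Union>n. U n))"
    using open_U top by (auto simp: closedin_def Compl_eq_Diff_UNIV Diff_Diff_Int)
  moreover have "fsigma_in T (U n \<inter> S c b \<inter> low c)" if "c \<in> Field W" for n c b
    using open_U open_S[OF that] closedin_low metrizable
    by (intro fsigma_in_Int open_imp_fsigma_in closed_imp_fsigma_in)
  ultimately show ?thesis
    using assms closed_imp_fsigma_in unfolding pieces_def by auto
qed

lemma const_on_pieces: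
  assumes C: "C \<in> pieces" and xy: "x \<in> C" "y \<in> C"
  shows "f x = f y" "g x = g y"
proof -
  consider (out) "C = - (\<Union>n. U n)" | (stage) n c b where "c \<in> Field W" "C = U n \<inter> S c b \<inter> low c"
    using C unfolding pieces_def by auto
  then have "f x = f y \<and> g x = g y"
  proof cases
    case out
    then have "x \<notin> A" "y \<notin> A"
      using A_subset xy by blast+
    then show ?thesis
      using xy out unfolding f_def g_def by simp
  next
    case stage
    have "g x = real n + 1" "g y = real n + 1"
      using stage xy idx_eq unfolding g_def by auto
    then show ?thesis
      using f_const[OF stage(1)] xy stage(2) by simp
  qed
  then show "f x = f y" "g x = g y" by simp_all
qed

end

section \<open>The main construction\<close>

context Polish_ordinal
begin

text \<open>The reduction property for sequences is applied to the pair padded with empty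
  sets.\<close>

lemma Sig_reduction_pair:
  assumes I: "is_seg r I" "big I" and V: "V True \<in> Sig I" "V False \<in> Sig I"
  obtains U :: "bool \<Rightarrow> 'a set" where "\<And>b. U b \<in> Sig I" "\<And>b. U b \<subseteq> V b"
    "(\<Union>b. U b) = (\<Union>b. V b)" "U True \<inter> U False = {}"
proof -
  define Q where "Q n = (if n = 0 then V True else if n = 1 then V False else {})" for n :: nat
  have "Q n \<in> Sig I" for n
    unfolding Q_def using V empty_Sig[OF I(1)] by simp
  then obtain R where R: "\<And>n::nat. R n \<in> Sig I" "\<And>n. R n \<subseteq> Q n" "(\<Union>n. R n) = (\<Union>n. Q n)"
      "\<And>m n. m \<noteq> n \<Longrightarrow> R m \<inter> R n = {}"
    using Sig_reduction[OF I, of Q] by metis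
  define U where "U b = R (if b then 0 else 1)" for b
  have QU: "(\<Union>n. Q n) = (\<Union>b. V b)"
  proof (rule antisym)
    show "(\<Union>n. Q n) \<subseteq> (\<Union>b. V b)"
      unfolding Q_def by (auto split: if_splits)
    have "V b \<subseteq> Q (if b then 0 else 1)" for b
      unfolding Q_def by simp
    then show "(\<Union>b. V b) \<subseteq> (\<Union>n. Q n)"
      by blast
  qed
  have RU: "(\<Union>n. R n) = (\<Union>b. U b)"
  proof (rule antisym)
    have "R n \<subseteq> (\<Union>b. U b)" for n
    proof (cases "n = 0 \<or> n = 1")
      case True
      then have "R n = U (n = 0)"
        unfolding U_def by auto
      then show ?thesis by blast
    next
      case False
      then show ?thesis
        using R(2)[of n] unfolding Q_def by simp
    qed
    then show "(\<Union>n. R n) \<subseteq> (\<Union>b. U b)"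
      by blast
    show "(\<Union>b. U b) \<subseteq> (\<Union>n. R n)"
      unfolding U_def by blast
  qed
  show thesis
  proof
    show "U b \<in> Sig I" for b
      unfolding U_def by (rule R(1))
    show "U b \<subseteq> V b" for b
      using R(2)[of "if b then 0 else 1"] unfolding U_def Q_def by (cases b) auto
    show "(\<Union>b. U b) = (\<Union>b. V b)"
      using QU RU R(3) by simp
    show "U True \<inter> U False = {}"
      unfolding U_def using R(4)[of 0 1] by simp
  qed
qed

text \<open>The construction for a countable limit ordinal \<open>W\<close>. The diagonal sequence
  is fixed before any competing topology is chosen, so one set \<open>A\<close> defeats all of
  them.\<close>

lemma beta_star_not_multiplicative:
  assumes unc: "uncountable (UNIV :: 'a set)" and r: "countable (Field r)" "big (Field r)"
    and W: "Well_order W" "countable (Field W)" "Field W \<noteq> {}"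
    and no_max: "\<And>a. a \<in> Field W \<Longrightarrow> \<exists>b\<in>Field W. a \<in> wo_below W b"
  shows "\<exists>f g. f \<in> baire_class T r \<and> g \<in> baire_class T r \<and>
           beta_star_le T r f W \<and> beta_star_le T r g W \<and> \<not> beta_star_le T r (\<lambda>x. f x * g x) W"
proof -
  let ?R = "Field r"
  have ne: "?R \<noteq> {}"
    using r(2) unfolding big_def by blast
  obtain S0 :: "nat \<Rightarrow> 'a set" where S0: "\<And>n. S0 n \<in> Sig ?R"
      "\<And>B. (\<And>n. B n \<in> Sig ?R) \<Longrightarrow> \<exists>x. \<forall>n. x \<in> S0 n \<longleftrightarrow> x \<in> B n"
    using Sig_diagonal[OF unc r] by blast
  define P where "P = Field W \<times> (UNIV :: bool set)"
  have cP: "countable P"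
    unfolding P_def using W(2) by (intro countable_SIGMA) auto
  \<comment> \<open>The diagonal sequence is distributed over the pairs (c, b). Reduction then makes
    the two sets of each stage disjoint without changing their union.\<close>
  define S1 where "S1 c b = S0 (to_nat_on P (c, b))" for c b
  have "\<exists>U. (\<forall>b. U b \<in> Sig ?R \<and> U b \<subseteq> S1 c b) \<and> (\<Union>b. U b) = (\<Union>b. S1 c b) \<and> U True \<inter> U False = {}" for c
    using Sig_reduction_pair[OF is_seg_Field r(2), of "S1 c"] S0(1) unfolding S1_def by metis
  then obtain S where S: "\<And>c b. S c b \<in> Sig ?R" "\<And>c b. S c b \<subseteq> S1 c b"
      "\<And>c. (\<Union>b. S c b) = (\<Union>b. S1 c b)" "\<And>c. S c True \<inter> S c False = {}"
    by metis
  define e where "e = from_nat_into (Field W)"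
  have er: "range e = Field W"
    unfolding e_def using range_from_nat_into[OF W(3,2)] .
  \<comment> \<open>All points voted on up to stage \<open>e n\<close>; reducing this sequence
    yields disjoint sets with the same bound on stages.\<close>
  define V where "V n = (\<Union>c\<in>insert (e n) (wo_below W (e n)). \<Union>b. S c b)" for n
  have V: "V n \<in> Sig ?R" for n
  proof -
    have "countable (wo_below W (e n))"
      using W(2) wo_below_subset_Field countable_subset by metis
    then have "countable ((\<lambda>(c, b). S c b) ` (insert (e n) (wo_below W (e n)) \<times> UNIV))"
      by (intro countable_image countable_SIGMA) auto
    then have "\<Union>((\<lambda>(c, b). S c b) ` (insert (e n) (wo_below W (e n)) \<times> UNIV)) \<in> Sig ?R"
      using S(1) by (intro Sig_Union_countable is_seg_Field) auto
    also have "\<Union>((\<lambda>(c, b). S c b) ` (insert (e n) (wo_below W (e n)) \<times> UNIV)) = V n"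
      unfolding V_def by auto
    finally show ?thesis .
  qed
  obtain U where U: "\<And>n::nat. U n \<in> Sig ?R" "\<And>n. U n \<subseteq> V n" "(\<Union>n. U n) = (\<Union>n. V n)"
      "\<And>m n. m \<noteq> n \<Longrightarrow> U m \<inter> U n = {}"
    using Sig_reduction[OF is_seg_Field r(2), of V] V by metis
  define \<Q> where "\<Q> = range U \<union> (\<lambda>(c, b). S c b) ` P"
  have \<Q>: "countable \<Q>" "\<Q> \<noteq> {}" "\<Q> \<subseteq> Sig ?R"
    unfolding \<Q>_def using cP U(1) S(1) by auto
  have "\<exists>T'. refines ?R T' \<and> openin T' (from_nat_into \<Q> n)" for n
    using Sig_refinement[OF is_seg_Field] from_nat_into[OF \<Q>(2), of n] \<Q>(3) by blast
  then obtain T' where T': "refines ?R T'" and op: "\<And>n. openin T' (from_nat_into \<Q> n)"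
    using refines_join[OF is_seg_Field, of "from_nat_into \<Q>"] by blast
  have opQ: "openin T' Q" if "Q \<in> \<Q>" for Q
    using op[of "to_nat_on \<Q> Q"] from_nat_into_to_nat_on[OF \<Q>(1) that] by simp
  have T'_top: "Polish_top T'" "topspace T' = UNIV" "metrizable_space T'"
    using T' Polish_top_imp_metrizable unfolding refines_def by auto
  interpret stratification T' W S U e
  proof
    show "openin T' (S c b)" if "c \<in> Field W" for c b
    proof (rule opQ)
      show "S c b \<in> \<Q>"
        unfolding \<Q>_def P_def using that by (intro UnI2 image_eqI[of _ _ "(c, b)"]) auto
    qed
    show "openin T' (U n)" for n
      by (rule opQ) (simp add: \<Q>_def)
    show "e n \<in> Field W" for n
      using er by blast
    show "\<exists>c\<in>insert (e n) (wo_below W (e n)). \<exists>b. x \<in> S c b" if "x \<in> U n" for n x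
      using U(2)[of n] that unfolding V_def by blast
    show "S c b \<subseteq> (\<Union>n. U n)" if c: "c \<in> Field W" for c b
    proof -
      obtain n where n: "c = e n"
        using c er by blast
      show ?thesis
        unfolding U(3) V_def n by blast
    qed
  qed (use T'_top W no_max S(4) U(4) in auto)
  note cover = const_on_fsigma_cover_baire[OF ne T' countable_pieces Union_pieces fsigma_pieces]
  have f: "f \<in> baire_one T'" "f \<in> baire_class T r"
    by (rule cover[OF _ const_on_pieces(1)]; assumption)+
  have g: "g \<in> baire_one T'" "g \<in> baire_class T r"
    by (rule cover[OF _ const_on_pieces(2)]; assumption)+
  have inT: "T' \<in> T_set T r h" if "h \<in> baire_one T'" for h
    using T' that unfolding T_set_def refines_def sigma_class_eq by blast
  have "\<not> beta_star_le T r (\<lambda>x. f x * g x) W"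
  proof
    assume "beta_star_le T r (\<lambda>x. f x * g x) W"
    then obtain T2 where T2: "T2 \<in> T_set T r (\<lambda>x. f x * g x)" and "beta_le T2 (\<lambda>x. f x * g x) W"
      unfolding beta_star_le_def by blast
    then have empty: "osc_deriv T2 (indicator A) 1 W = {}"
      unfolding beta_le_def f_times_g by simp
    have sub: "\<And>V. openin T2 V \<Longrightarrow> V \<in> Sig ?R" and "openin T2 UNIV"
      using T2 openin_topspace[of T] Polish_ordinal.top[OF Polish_ordinal_axioms]
      unfolding T_set_def sigma_class_eq by auto
    then have "topspace T2 = UNIV"
      using openin_subset by blast
    from osc_deriv_empty_stages[OF W(1) this empty] obtain B where
        B: "\<And>c b. openin T2 (B c b)" "\<And>x. \<exists>\<eta>\<in>Field W. (\<forall>c\<in>wo_below W \<eta>. \<forall>b. x \<notin> B c b) \<and>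
          x \<in> B \<eta> (x \<in> A) \<and> x \<notin> B \<eta> (x \<notin> A)"
      by blast
    \<comment> \<open>The negation sets up the contradiction: the diagonal point votes against the
      decision of \<open>T2\<close>.\<close>
    define B' where "B' n = (case from_nat_into P n of (c, b) \<Rightarrow> B c (\<not> b))" for n
    have "B' n \<in> Sig ?R" for n
      unfolding B'_def using sub B(1) by (auto split: prod.split)
    then obtain x where x: "\<And>n. x \<in> S0 n \<longleftrightarrow> x \<in> B' n"
      using S0(2)[of B'] by blast
    have S1: "x \<in> S1 c b \<longleftrightarrow> x \<in> B c (\<not> b)" if "c \<in> Field W" for c b
    proof -
      have "from_nat_into P (to_nat_on P (c, b)) = (c, b)"
        using that by (intro from_nat_into_to_nat_on cP) (simp add: P_def)
      then show ?thesis
        unfolding S1_def x B'_def by simp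
    qed
    obtain \<eta> where \<eta>: "\<eta> \<in> Field W" "\<And>c b. c \<in> wo_below W \<eta> \<Longrightarrow> x \<notin> B c b"
        "x \<in> B \<eta> (x \<in> A)" "x \<notin> B \<eta> (x \<notin> A)"
      using B(2)[of x] by blast
    have "x \<notin> S c b" if c: "c \<in> wo_below W \<eta>" for c b
      using S1[OF wo_below_FieldD[OF c]] \<eta>(2)[OF c] S(2)[of c b] by blast
    then have low: "x \<in> low \<eta>"
      unfolding low_def by blast
    \<comment> \<open>At \<eta> the point lies only in the set voting against its actual membership.
      Reduction kept the union of the pair, so some \<open>S \<eta> b\<close> contains
      \<open>x\<close>; as no earlier stage votes on \<open>x\<close>, that \<open>b\<close> decides
      membership and must be both truth values.\<close>
    have "x \<in> S1 \<eta> (x \<notin> A)" "x \<notin> S1 \<eta> (x \<in> A)"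
      using S1[OF \<eta>(1)] \<eta>(3,4) by simp_all
    then obtain b where b: "x \<in> S \<eta> b"
      using S(3)[of \<eta>] by blast
    have "(x \<in> A) = b"
      using A_iff[OF \<eta>(1) b low] .
    moreover have "x \<in> S1 \<eta> b"
      using S(2) b by (rule subsetD)
    ultimately show False
      using \<open>x \<notin> S1 \<eta> (x \<in> A)\<close> by simp
  qed
  then show ?thesis
    using f(2) g(2) inT[OF f(1)] inT[OF g(1)] beta_le_f beta_le_g unfolding beta_star_le_def
    by (intro exI[of _ f] exI[of _ g] conjI) (auto intro: bexI[of _ T'])
qed

end

theorem theorem3p7:
  fixes T :: "'a topology" and r :: "'o rel" and s :: "'z rel"
  assumes "Polish_top T" and "topspace T = UNIV" and "uncountable (UNIV :: 'a set)"
    and "Well_order r" and "countable (Field r)" and "\<not> (\<exists>b. Field r \<subseteq> {b})"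
    and "Well_order s" and "countable (Field s)" and "Field s \<noteq> {}"
  shows "\<exists>f g. f \<in> baire_class T r \<and> g \<in> baire_class T r \<and>
           beta_star_le T r f (omega_exp s) \<and> beta_star_le T r g (omega_exp s) \<and>
           \<not> beta_star_le T r (\<lambda>x. f x * g x) (omega_exp s)"
proof -
  interpret Polish_ordinal T r
    using assms by unfold_locales
  have "big (Field r)"
    using assms(6) by (simp add: big_def)
  moreover have "Field (omega_exp s) \<noteq> {}"
    unfolding Field_omega_exp fin_supp_def by (auto intro: exI[of _ "\<lambda>_. 0"])
  ultimately show ?thesis
    using beta_star_not_multiplicative[OF assms(3,5)] Well_order_omega_exp[OF assms(7)]
      countable_omega_exp[OF assms(8)] omega_exp_no_max[OF assms(9)] by blast
qed

end
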